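(* Let $x_1,\dots,x_N\in\mathcal{X}$, let $k$ be a kernel on $\mathcal{X}$ with RKHS $\mathcal{H}$ and feature map $\Phi(x)=k(x,\cdot)$, and let $K_{s,s}=(k(x_i,x_j))_{i,j=1}^N$ be the kernel matrix. Let $A\in\{0,1\}^{N\times N}$ be the adjacency matrix encoding relations between datapoints ($A_{ij}=1$ if $x_i$ and $x_j$ are related). For linear maps $W:\mathcal{H}\to\mathbb{R}^K$ consider the contrastive loss $$\mathcal{L}_{sc}(W)=\big\|XW^{\top}WX^{\top}-(I+A)\big\|_F^2 ,$$ where $X$ is the matrix whose $i$-th row is $\Phi(x_i)^{\top}$, so that $XW^{\top}WX^{\top}$ is the $N\times N$ matrix with entries $\langle W\Phi(x_i),W\Phi(x_j)\rangle$. Let $k^*$ be the induced kernel of this loss, i.e. $k^*(x,x')=\langle W^*\Phi(x),W^*\Phi(x')\rangle$, where $W^*$ minimizes $\mathcal{L}_{sc}$ and has minimal RKHS norm among the minimizers. (i) If $K\ge N$, then $$k^*(x,x')=k_{x,s}K_{s,s}^{-1}(I+A)_+K_{s,s}^{-1}k_{s,x'} .$$ In the standard setting where relationships are pairwise (every datapoint has exactly one neighbor in $A$), $I+A$ has only positive or zero eigenvalues, so the projection $(\cdot)_+$ can be ignored. (ii) If $K<N$, then $$k^*(x,x')=k_{x,s}K_{s,s}^{-1}\,C_{:,\le K}\,D_{\le K,\le K}\,C_{:,\le K}^{\top}\,K_{s,s}^{-1}k_{s,x'} ,$$ where $CDC^{\top}=I+A$ is the eigendecomposition including only positive eigenvalues,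 with eigenvalues in descending order.
   Context: A linear map $W:\mathcal{H}\to\mathbb{R}^K$ has components $W_1,\dots,W_K\in\mathcal{H}$, with $W\phi=(\langle W_i,\phi\rangle_{\mathcal{H}})_{i=1}^K$, and RKHS norm $\|W\|_{\mathcal{H}}=\sqrt{\sum_{i=1}^K\langle W_i,W_i\rangle_{\mathcal{H}}}$. For $x\in\mathcal{X}$, $k_{x,s}\in\mathbb{R}^{1\times N}$ is the row vector with entries $k(x,x_i)$, and $k_{s,x}=k_{x,s}^{\top}$. $(I+A)_+$ is the projection of $I+A$ onto its eigenspace of positive eigenvalues: if $A$ has eigenvectors $v_i$ (orthonormal) with eigenvalues $e_i$, then $(I+A)_+=\sum_i\max(e_i+1,0)\,v_iv_i^{\dagger}$. $C_{:,\le K}$ consists of the first $K$ columns of $C$, and $D_{\le K,\le K}$ is the $K\times K$ matrix of the first $K$ rows and columns of $D$.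
   Formalization: In (ii), CDCᵀ is (I+A)_+ (it cannot be I+A if negative eigenvalues occur); the formula holds for some ordered eigendecomposition, and for every one if the K-th and (K+1)-st positive eigenvalues differ, since with ties C is not unique. A is symmetric and K_{s,s} invertible. *)

theory Defs
  imports
    "HOL-Analysis.Inner_Product"
    "Jordan_Normal_Form.Gauss_Jordan_Elimination"
    "Jordan_Normal_Form.Char_Poly"
begin

text \<open>
  Conventions: the datapoints \<open>x 0, \<dots>, x (N - 1)\<close>, the components \<open>W 0, \<dots>, W (K - 1)\<close> of a
  linear map, and all rows and columns are indexed from 0. Values of \<open>x\<close> and \<open>W\<close> at larger
  indices are never used.
\<close>

subsection \<open>Kernels and reproducing kernel Hilbert spaces\<close>

definition psd_kernel :: "('x \<Rightarrow> 'x \<Rightarrow> real) \<Rightarrow> bool" where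
  "psd_kernel k \<longleftrightarrow> (\<forall>y z. k y z = k z y) \<and>
     (\<forall>(n::nat) x c. 0 \<le> (\<Sum>i<n. \<Sum>j<n. c i * c j * k (x i) (x j)))"

text \<open>
  The RKHS is a Hilbert space \<open>'h\<close> whose elements are functions on \<open>'x\<close> by way of the injective
  map \<open>ev\<close> (\<open>ev f y\<close> is the value of \<open>f\<close> at \<open>y\<close>). The reproducing property forces \<open>ev\<close> to be
  linear, and \<open>\<Phi> y\<close> is the element representing the function \<open>k y\<close>.
\<close>

definition is_rkhs ::
  "('x \<Rightarrow> 'x \<Rightarrow> real) \<Rightarrow> ('h::{real_inner,complete_space} \<Rightarrow> 'x \<Rightarrow> real) \<Rightarrow> ('x \<Rightarrow> 'h) \<Rightarrow> bool" where
  "is_rkhs k ev \<Phi> \<longleftrightarrow>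
     inj ev \<and> (\<forall>y. ev (\<Phi> y) = k y) \<and> (\<forall>f y. ev f y = inner f (\<Phi> y))"

definition kernel_matrix :: "('x \<Rightarrow> 'x \<Rightarrow> real) \<Rightarrow> nat \<Rightarrow> (nat \<Rightarrow> 'x) \<Rightarrow> real mat" where
  "kernel_matrix k N x = mat N N (\<lambda>(i, j). k (x i) (x j))"

definition kernel_row :: "('x \<Rightarrow> 'x \<Rightarrow> real) \<Rightarrow> nat \<Rightarrow> (nat \<Rightarrow> 'x) \<Rightarrow> 'x \<Rightarrow> real mat" where
  "kernel_row k N x y = mat 1 N (\<lambda>(i, j). k y (x j))"

text \<open>Unspecified unless \<open>M\<close> is invertible.\<close>

definition mat_inv :: "real mat \<Rightarrow> real mat" where
  "mat_inv M = the (mat_inverse M)"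

text \<open>The only entry of the 1-by-1 matrix \<open>k\<^bsub>y,s\<^esub> K\<^bsub>s,s\<^esub>\<^sup>-\<^sup>1 M K\<^bsub>s,s\<^esub>\<^sup>-\<^sup>1 k\<^bsub>s,z\<^esub>\<close>.\<close>

definition kernel_sandwich ::
  "('x \<Rightarrow> 'x \<Rightarrow> real) \<Rightarrow> nat \<Rightarrow> (nat \<Rightarrow> 'x) \<Rightarrow> real mat \<Rightarrow> 'x \<Rightarrow> 'x \<Rightarrow> real" where
  "kernel_sandwich k N x M y z =
     (kernel_row k N x y * mat_inv (kernel_matrix k N x) * M *
      mat_inv (kernel_matrix k N x) * transpose_mat (kernel_row k N x z)) $$ (0, 0)"

subsection \<open>The contrastive loss and its induced kernel\<close>

definition adjacency_matrix :: "nat \<Rightarrow> real mat \<Rightarrow> bool" where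
  "adjacency_matrix N A \<longleftrightarrow> A \<in> carrier_mat N N \<and>
     (\<forall>i<N. \<forall>j<N. A $$ (i, j) \<in> {0, 1}) \<and> transpose_mat A = A"

definition apply_map :: "nat \<Rightarrow> (nat \<Rightarrow> 'h::real_inner) \<Rightarrow> 'h \<Rightarrow> real vec" where
  "apply_map K W \<phi> = vec K (\<lambda>i. inner (W i) \<phi>)"

definition rkhs_norm :: "nat \<Rightarrow> (nat \<Rightarrow> 'h::real_inner) \<Rightarrow> real" where
  "rkhs_norm K W = sqrt (\<Sum>i<K. inner (W i) (W i))"

definition map_kernel :: "('x \<Rightarrow> 'h::real_inner) \<Rightarrow> nat \<Rightarrow> (nat \<Rightarrow> 'h) \<Rightarrow> 'x \<Rightarrow> 'x \<Rightarrow> real" where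
  "map_kernel \<Phi> K W y z = scalar_prod (apply_map K W (\<Phi> y)) (apply_map K W (\<Phi> z))"

definition frobenius_norm :: "real mat \<Rightarrow> real" where
  "frobenius_norm M = sqrt (\<Sum>i<dim_row M. \<Sum>j<dim_col M. (M $$ (i, j))\<^sup>2)"

definition contrastive_loss ::
  "('x \<Rightarrow> 'h::real_inner) \<Rightarrow> nat \<Rightarrow> (nat \<Rightarrow> 'x) \<Rightarrow> nat \<Rightarrow> real mat \<Rightarrow> (nat \<Rightarrow> 'h) \<Rightarrow> real" where
  "contrastive_loss \<Phi> N x K A W =
     (frobenius_norm (kernel_matrix (map_kernel \<Phi> K W) N x - (1\<^sub>m N + A)))\<^sup>2"

definition induced_kernel ::
  "('x \<Rightarrow> 'h::real_inner) \<Rightarrow> nat \<Rightarrow> (nat \<Rightarrow> 'x) \<Rightarrow> nat \<Rightarrow> real mat \<Rightarrow> ('x \<Rightarrow> 'x \<Rightarrow> real) \<Rightarrow> bool" where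
  "induced_kernel \<Phi> N x K A kstar \<longleftrightarrow>
     (\<exists>W. is_arg_min (rkhs_norm K) (is_arg_min (contrastive_loss \<Phi> N x K A) (\<lambda>_. True)) W \<and>
          kstar = map_kernel \<Phi> K W)"

subsection \<open>The positive part of \<open>I + A\<close> and truncated eigendecompositions\<close>

definition orthonormal_eigenbasis ::
  "nat \<Rightarrow> real mat \<Rightarrow> (nat \<Rightarrow> real vec) \<Rightarrow> (nat \<Rightarrow> real) \<Rightarrow> bool" where
  "orthonormal_eigenbasis N A v e \<longleftrightarrow>
     (\<forall>i<N. eigenvector A (v i) (e i)) \<and>
     (\<forall>i<N. \<forall>j<N. scalar_prod (v i) (v j) = (if i = j then 1 else 0))"

text \<open>
  \<open>(I + A)\<^sub>+\<close>. For symmetric \<open>A\<close> an orthonormal eigenbasis exists, and the resulting matrix does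
  not depend on its choice.
\<close>

definition pos_part_I_plus :: "nat \<Rightarrow> real mat \<Rightarrow> real mat" where
  "pos_part_I_plus N A =
     (THE P. \<exists>v e. orthonormal_eigenbasis N A v e \<and>
        P = mat N N (\<lambda>(a, b). \<Sum>i<N. max (e i + 1) 0 * (v i $ a * v i $ b)))"

text \<open>
  The columns of \<open>C\<close> are orthonormal eigenvectors of \<open>I + A\<close>, one for each positive eigenvalue
  counted with multiplicity. When \<open>I + A\<close> has negative eigenvalues, a decomposition that keeps
  only the positive ones multiplies out to \<open>(I + A)\<^sub>+\<close> and not to \<open>I + A\<close>; this equation also
  guarantees that no positive eigenvalue is left out.
\<close>

definition positive_eigendecomposition :: "nat \<Rightarrow> real mat \<Rightarrow> real mat \<Rightarrow> real mat \<Rightarrow> bool" where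
  "positive_eigendecomposition N A C D \<longleftrightarrow>
     C \<in> carrier_mat N (dim_col C) \<and>
     D \<in> carrier_mat (dim_col C) (dim_col C) \<and>
     diagonal_mat D \<and>
     transpose_mat C * C = 1\<^sub>m (dim_col C) \<and>
     (1\<^sub>m N + A) * C = C * D \<and>
     (\<forall>i<dim_col C. 0 < D $$ (i, i)) \<and>
     (\<forall>j<dim_col C. \<forall>i\<le>j. D $$ (j, j) \<le> D $$ (i, i)) \<and>
     C * D * transpose_mat C = pos_part_I_plus N A"

text \<open>If fewer than \<open>m\<close> columns (rows) are available, all of them are taken.\<close>

definition first_cols :: "nat \<Rightarrow> real mat \<Rightarrow> real mat" where
  "first_cols m C = mat (dim_row C) (min m (dim_col C)) (\<lambda>ij. C $$ ij)"

definition leading_block :: "nat \<Rightarrow> real mat \<Rightarrow> real mat" where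
  "leading_block m D = mat (min m (dim_row D)) (min m (dim_col D)) (\<lambda>ij. D $$ ij)"

end

theory Submission
  imports Defs "HOL-Analysis.Function_Topology"
begin

text \<open>
  Replacing the components of \<open>W\<close> by their projections onto the span of the \<open>\<Phi> (x j)\<close> keeps the loss
  and lowers the norm, so a norm-minimal minimizer lies in that span and is determined by the matrix
  \<open>V\<close> of its values at the datapoints; the induced kernel is \<open>k\<^bsub>y,s\<^esub> K\<^sup>-\<^sup>1 V\<^sup>T V K\<^sup>-\<^sup>1 k\<^bsub>s,z\<^esub>\<close>. Since the kernel
  matrix is invertible, \<open>V\<close> is an unconstrained minimizer of \<open>|V\<^sup>T V - B|\<close> with \<open>B = I + A\<close>.
  Stationarity gives \<open>G (G - B) = 0\<close> for \<open>G = V\<^sup>T V\<close>, so \<open>G\<close> is the sum of the \<open>\<mu>\<^sub>i u\<^sub>i u\<^sub>i\<^sup>T\<close>, \<open>i \<in> S\<close>, for an eigenbasis \<open>u\<close>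
  of \<open>B\<close> and a set \<open>S\<close> of at most \<open>K\<close> positive eigenvalues; exchanging elements of \<open>S\<close> shows that it
  consists of the largest ones.
\<close>

section \<open>Symmetric matrices and orthonormal eigenbases\<close>

text \<open>A minimizer of the loss is far from unique: rotating the rows of V leaves G unchanged,
  and when the eigenvalues of B at positions K and K + 1 coincide and are positive, the loss does
  not even determine G. No eigenbasis of B fixed in advance can therefore be expected to diagonalize
  G. The basis u is instead built around the given minimizer: G (G - B) = 0 turns each eigenvector
  of G with nonzero eigenvalue into an eigenvector of B with the same eigenvalue, and these are
  completed inside their orthogonal complement. Other bases come in only afterwards, through
  matrices f(B) that do not depend on the basis. Such an f must separate kept from dropped
  eigenvalues, which is where a gap at position K is used; when at most K eigenvalues are positive,
  f(t) = max(t, 0) does it without a gap.\<close>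

text \<open>
  Vectors of length \<open>n\<close> are functions on \<open>nat\<close> of which only the values below \<open>n\<close> matter;
  families of vectors have the index of the member as first argument.
\<close>

definition ip :: "nat \<Rightarrow> (nat \<Rightarrow> real) \<Rightarrow> (nat \<Rightarrow> real) \<Rightarrow> real" where
  "ip n u v = (\<Sum>a<n. u a * v a)"

definition mv :: "nat \<Rightarrow> (nat \<Rightarrow> nat \<Rightarrow> real) \<Rightarrow> (nat \<Rightarrow> real) \<Rightarrow> nat \<Rightarrow> real" where
  "mv n B u = (\<lambda>a. \<Sum>b<n. B a b * u b)"

definition orthonormal :: "nat \<Rightarrow> nat \<Rightarrow> (nat \<Rightarrow> nat \<Rightarrow> real) \<Rightarrow> bool" where
  "orthonormal n m u \<longleftrightarrow> (\<forall>i<m. \<forall>j<m. ip n (u i) (u j) = (if i = j then 1 else 0))"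

definition sym_on :: "nat \<Rightarrow> (nat \<Rightarrow> nat \<Rightarrow> real) \<Rightarrow> bool" where
  "sym_on n B \<longleftrightarrow> (\<forall>a<n. \<forall>b<n. B a b = B b a)"

text \<open>\<open>m\<close> may be smaller than \<open>n\<close>: partial families are what gets
  extended to eigenbases.\<close>

definition eigenfamily ::
  "nat \<Rightarrow> (nat \<Rightarrow> nat \<Rightarrow> real) \<Rightarrow> nat \<Rightarrow> (nat \<Rightarrow> nat \<Rightarrow> real) \<Rightarrow> (nat \<Rightarrow> real) \<Rightarrow> bool" where
  "eigenfamily n B m u \<mu> \<longleftrightarrow>
     orthonormal n m u \<and> (\<forall>i<m. \<forall>a<n. mv n B (u i) a = \<mu> i * u i a)"

text \<open>The coefficients \<open>h\<close> are kept apart from the eigenvalues so that one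
  expression covers B itself, f(B) and truncations to the first \<open>m\<close> members.\<close>

definition spectral_sum :: "nat \<Rightarrow> (nat \<Rightarrow> nat \<Rightarrow> real) \<Rightarrow> (nat \<Rightarrow> real) \<Rightarrow> nat \<Rightarrow> nat \<Rightarrow> real" where
  "spectral_sum m u h a b = (\<Sum>i<m. h i * u i a * u i b)"

section \<open>Inner products and the action of a matrix\<close>

lemma ip_commute: "ip n u v = ip n v u"
  by (simp add: ip_def mult.commute)

lemma ip_add_right: "ip n u (\<lambda>a. v a + w a) = ip n u v + ip n u w"
  by (simp add: ip_def distrib_left sum.distrib)

lemma ip_add_left: "ip n (\<lambda>a. v a + w a) u = ip n v u + ip n w u"
  by (simp add: ip_def distrib_right sum.distrib)

lemma ip_diff_right: "ip n u (\<lambda>a. v a - w a) = ip n u v - ip n u w"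
  by (simp add: ip_def right_diff_distrib sum_subtractf)

lemma ip_scale_right: "ip n u (\<lambda>a. c * v a) = c * ip n u v"
  by (simp add: ip_def sum_distrib_left mult_ac)

lemma ip_scale_left: "ip n (\<lambda>a. c * v a) u = c * ip n v u"
  by (simp add: ip_def sum_distrib_left mult_ac)

lemma ip_sum_right: "ip n u (\<lambda>a. \<Sum>i\<in>I. f i a) = (\<Sum>i\<in>I. ip n u (f i))"
  unfolding ip_def sum_distrib_left by (rule sum.swap)

lemma ip_cong: "(\<And>a. a < n \<Longrightarrow> u a = u' a) \<Longrightarrow> (\<And>a. a < n \<Longrightarrow> v a = v' a) \<Longrightarrow> ip n u v = ip n u' v'"
  by (simp add: ip_def)

lemma ip_self_nonneg: "0 \<le> ip n u u"
  by (simp add: ip_def sum_nonneg)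

lemma ip_self_eq_0: "ip n u u = 0 \<longleftrightarrow> (\<forall>a<n. u a = 0)"
  by (auto simp: ip_def sum_nonneg_eq_0_iff)

lemma mv_cong: "(\<And>a. a < n \<Longrightarrow> u a = u' a) \<Longrightarrow> mv n B u = mv n B u'"
  by (simp add: mv_def)

lemma mv_add: "mv n B (\<lambda>a. u a + v a) = (\<lambda>a. mv n B u a + mv n B v a)"
  by (simp add: mv_def distrib_left sum.distrib)

lemma mv_scale: "mv n B (\<lambda>a. c * u a) = (\<lambda>a. c * mv n B u a)"
  by (simp add: mv_def sum_distrib_left mult_ac)

lemma ip_mv_sym:
  assumes "sym_on n B" shows "ip n u (mv n B v) = ip n (mv n B u) v"
proof -
  have "ip n u (mv n B v) = (\<Sum>a<n. \<Sum>b<n. u a * (B a b * v b))"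
    by (simp add: ip_def mv_def sum_distrib_left)
  also have "\<dots> = (\<Sum>b<n. \<Sum>a<n. u a * (B a b * v b))"
    by (rule sum.swap)
  also have "\<dots> = (\<Sum>b<n. \<Sum>a<n. (B b a * u a) * v b)"
    using assms by (intro sum.cong refl) (auto simp: sym_on_def)
  also have "\<dots> = ip n (mv n B u) v"
    by (simp add: ip_def mv_def sum_distrib_right)
  finally show ?thesis .
qed

section \<open>Orthonormal families and dimension\<close>

lemma exists_orthogonal_nonzero:
  fixes u :: "nat \<Rightarrow> nat \<Rightarrow> real"
  assumes "m < n"
  obtains z where "\<exists>a<n. z a \<noteq> 0" "\<And>i. i < m \<Longrightarrow> ip n (u i) z = 0"
proof -
  let ?M = "mat n n (\<lambda>(i, j). if i < m then u i j else 0) :: real mat"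
  have M: "?M \<in> carrier_mat n n" by simp
  have "det ?M = 0"
  proof -
    \<comment> \<open>Since \<open>m < n\<close>, the last row is one of those padded with zeros,
      which makes the determinant vanish.\<close>
    have "?M = mat\<^sub>r n n (\<lambda>i. if i = n - 1 then 0\<^sub>v n else vec n (\<lambda>j. if i < m then u i j else 0))"
      using \<open>m < n\<close> by (intro eq_matI) (auto simp: mat_of_rows_def)
    then show ?thesis
      using \<open>m < n\<close> by (simp only:) (rule det_row_0, auto)
  qed
  then obtain v where v: "v \<in> carrier_vec n" "v \<noteq> 0\<^sub>v n" "?M *\<^sub>v v = 0\<^sub>v n"
    using det_0_iff_vec_prod_zero_field[OF M] by blast
  have "\<exists>a<n. v $ a \<noteq> 0"
  proof (rule ccontr)
    assume "\<not> (\<exists>a<n. v $ a \<noteq> 0)"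
    then have "v = 0\<^sub>v n" using v(1) by (intro eq_vecI) auto
    with v(2) show False by contradiction
  qed
  moreover have "ip n (u i) (($) v) = 0" if "i < m" for i
  proof -
    have "0 = (?M *\<^sub>v v) $ i" using v \<open>m < n\<close> that by simp
    also have "\<dots> = ip n (u i) (($) v)"
      using that \<open>m < n\<close> v(1) by (simp add: scalar_prod_def ip_def lessThan_atLeast0)
    finally show ?thesis by simp
  qed
  ultimately show thesis by (rule that)
qed

text \<open>More than n vectors of length n admit a nontrivial vanishing combination: its
  coefficients solve n equations, found by reading the family transposed. Pairing with
  \<open>u j\<close> isolates the coefficient \<open>c j\<close>.\<close>

lemma orthonormal_le_dim:
  assumes "orthonormal n m u" shows "m \<le> n"
proof (rule ccontr)
  assume "\<not> m \<le> n"
  then have "n < m" by simp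
  then obtain c where c: "\<exists>i<m. c i \<noteq> 0" "\<And>a. a < n \<Longrightarrow> ip m (\<lambda>i. u i a) c = 0"
    by (rule exists_orthogonal_nonzero[where u = "\<lambda>a i. u i a"]) blast
  have "c j = 0" if "j < m" for j
  proof -
    have "0 = ip n (u j) (\<lambda>a. ip m (\<lambda>i. u i a) c)"
      using c(2) by (simp add: ip_def[of n])
    also have "\<dots> = (\<Sum>i<m. c i * ip n (u j) (u i))"
      unfolding ip_def[of m] mult.commute[of _ "c _"] ip_sum_right by (simp add: ip_scale_right)
    also have "\<dots> = (\<Sum>i<m. if i = j then c i else 0)"
      using assms that by (intro sum.cong) (auto simp: orthonormal_def)
    finally show ?thesis using that by simp
  qed
  with c show False by blast
qed

text \<open>Orthonormal rows of a square matrix make its transpose a right inverse, hence also a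
  left inverse.\<close>

lemma orthonormal_complete:
  assumes "orthonormal n n u" "a < n" "b < n"
  shows "(\<Sum>i<n. u i a * u i b) = (if a = b then 1 else 0)"
proof -
  let ?Q = "mat n n (\<lambda>(i, a). u i a)"
  have "?Q * transpose_mat ?Q = 1\<^sub>m n"
    using assms(1) by (intro eq_matI) 
      (auto simp: scalar_prod_def orthonormal_def ip_def lessThan_atLeast0)
  then have "transpose_mat ?Q * ?Q = 1\<^sub>m n"
    by (rule mat_mult_left_right_inverse[rotated 2]) auto
  then have "(transpose_mat ?Q * ?Q) $$ (a, b) = (1\<^sub>m n) $$ (a, b)"
    by simp
  then show ?thesis
    using assms(2,3) by (simp add: scalar_prod_def lessThan_atLeast0)
qed

lemma orthonormal_expansion:
  assumes "orthonormal n n u" "a < n"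
  shows "x a = (\<Sum>i<n. ip n (u i) x * u i a)"
proof -
  have "(\<Sum>i<n. ip n (u i) x * u i a) = (\<Sum>i<n. \<Sum>b<n. x b * (u i a * u i b))"
    by (simp add: ip_def sum_distrib_left sum_distrib_right mult_ac)
  also have "\<dots> = (\<Sum>b<n. x b * (\<Sum>i<n. u i a * u i b))"
    unfolding sum_distrib_left by (rule sum.swap)
  also have "\<dots> = (\<Sum>b<n. if b = a then x b else 0)"
    using assms by (intro sum.cong) (auto simp: orthonormal_complete)
  finally show ?thesis using assms by simp
qed

section \<open>The spectral theorem through the Rayleigh quotient\<close>

lemma linear_term_zero:
  fixes b c :: real
  assumes "\<And>t. t * b + t\<^sup>2 * c \<le> 0"
  shows "b = 0"
proof -
  \<comment> \<open>The test point is t = b / s, where the expression equals b^2 (s + c) / s^2;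
    adding 1 keeps s positive and s + c at least 1.\<close>
  define s where "s = \<bar>c\<bar> + 1"
  have s: "s > 0" "s + c \<ge> 1" by (auto simp: s_def)
  have "b\<^sup>2 * (s + c) / s\<^sup>2 = (b / s) * b + (b / s)\<^sup>2 * c"
    using s(1) by (simp add: field_simps power2_eq_square)
  also have "\<dots> \<le> 0" by (rule assms)
  finally have "b\<^sup>2 * (s + c) \<le> 0"
    using s(1) by (simp add: divide_le_0_iff)
  moreover have "b\<^sup>2 * 1 \<le> b\<^sup>2 * (s + c)"
    using s(2) by (intro mult_left_mono) auto
  ultimately have "b\<^sup>2 \<le> 0" by linarith
  then show ?thesis by simp
qed

text \<open>By homogeneity only unit vectors of the complement matter, and they form a compact set
  on which the quadratic form attains its maximum.\<close>

lemma rayleigh_attained: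
  assumes "m < n"
  obtains v where "ip n v v = 1" "\<And>i. i < m \<Longrightarrow> ip n (u i) v = 0"
    "\<And>z. \<forall>i<m. ip n (u i) z = 0 \<Longrightarrow>
       ip n z (mv n B z) \<le> ip n v (mv n B v) * ip n z z"
proof -
  \<comment> \<open>Entries from \<open>n\<close> on are set to 0; left free, they would make the
    set unbounded.\<close>
  define S where "S = {x::nat \<Rightarrow> real. (\<forall>a. n \<le> a \<longrightarrow> x a = 0) \<and> ip n x x = 1 \<and> (\<forall>i<m. ip n (u i) x = 0)}"
  have normalize: "\<exists>x\<in>S. \<exists>c>0. c\<^sup>2 = ip n z z \<and> (\<forall>a<n. z a = c * x a)"
    if z: "\<exists>a<n. z a \<noteq> 0" "\<And>i. i < m \<Longrightarrow> ip n (u i) z = 0" for z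
  proof -
    let ?c = "sqrt (ip n z z)"
    let ?x = "\<lambda>a. if a < n then z a / ?c else 0"
    have pos: "ip n z z > 0"
      using z(1) ip_self_nonneg[of n z] ip_self_eq_0[of n z] by (auto simp: less_le)
    have x: "ip n w ?x = ip n w z / ?c" for w
    proof -
      have "ip n w ?x = ip n w (\<lambda>a. (1 / ?c) * z a)" by (rule ip_cong) auto
      also have "\<dots> = 1 / ?c * ip n w z" by (rule ip_scale_right)
      finally show ?thesis by simp
    qed
    have "ip n ?x ?x = ip n z z / ?c / ?c"
      unfolding x[of ?x] ip_commute[of n ?x z] x[of z] ..
    then have "ip n ?x ?x = 1"
      using pos by simp
    then have "?x \<in> S" using z(2) by (simp add: S_def x)
    moreover have "?c > 0" "?c\<^sup>2 = ip n z z" using pos by auto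
    moreover have "\<forall>a<n. z a = ?c * ?x a" using pos by simp
    ultimately show ?thesis by (intro bexI[of _ ?x] exI[of _ ?c] conjI)
  qed
  have coord: "continuous_on T (\<lambda>x. x a)" for T and a :: nat
    by (rule continuous_on_subset[OF continuous_on_product_coordinates subset_UNIV])
  have cont_ip: "continuous_on T (\<lambda>x. ip n (f x) (g x))"
    if "\<And>a. continuous_on T (\<lambda>x. f x a)" "\<And>a. continuous_on T (\<lambda>x. g x a)" for T :: "(nat \<Rightarrow> real) set" and f g
    unfolding ip_def by (intro continuous_on_sum continuous_on_mult that)
  \<comment> \<open>Tychonoff: the functions into [-1, 1] form a compact set in the product
    topology, and S is a closed subset of it.\<close>
  have "compactin (product_topology (\<lambda>i. euclidean) (UNIV::nat set)) (PiE UNIV (\<lambda>a. {-1..1::real}))"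
    by (simp add: compactin_PiE)
  then have cube: "compact (PiE (UNIV::nat set) (\<lambda>a. {-1..1::real}))"
    by (simp add: euclidean_product_topology)
  have "S = (\<Inter>a\<in>{n..}. {x. x a = 0}) \<inter> {x. ip n x x = 1} \<inter> (\<Inter>i\<in>{..<m}. {x. ip n (u i) x = 0})"
    by (auto simp: S_def)
  then have "closed S"
    by (simp only:) (intro closed_Int closed_INT closed_Collect_eq cont_ip coord continuous_on_const ballI)
  moreover have "S \<subseteq> PiE UNIV (\<lambda>a. {-1..1})"
  proof
    fix x assume x: "x \<in> S"
    have "\<bar>x a\<bar> \<le> 1" for a
    proof (cases "a < n")
      case True
      then have "x a * x a \<le> ip n x x"
        unfolding ip_def by (intro member_le_sum) auto
      then show ?thesis using x
        by (simp add: S_def power2_eq_square flip: abs_square_le_1)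
    qed (use x in \<open>simp add: S_def\<close>)
    then show "x \<in> PiE UNIV (\<lambda>a. {-1..1})" by (auto simp: abs_le_iff minus_le_iff)
  qed
  ultimately have "compact S"
    using cube by (metis closed_Int_compact inf.absorb1)
  moreover have "S \<noteq> {}"
  proof -
    obtain z where "\<exists>a<n. z a \<noteq> 0" "\<And>i. i < m \<Longrightarrow> ip n (u i) z = 0"
      using assms by (rule exists_orthogonal_nonzero[where u = u]) blast
    from normalize[OF this] show ?thesis by blast
  qed
  moreover have "continuous_on S (\<lambda>x. ip n x (mv n B x))"
    unfolding mv_def by (intro cont_ip continuous_on_sum continuous_on_mult continuous_on_const coord)
  ultimately obtain v where v: "v \<in> S" "\<And>x. x \<in> S \<Longrightarrow> ip n x (mv n B x) \<le> ip n v (mv n B v)"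
    by (meson continuous_attains_sup)
  show thesis
  proof (rule that)
    show "ip n v v = 1" "\<And>i. i < m \<Longrightarrow> ip n (u i) v = 0"
      using v(1) by (auto simp: S_def)
    fix z assume z: "\<forall>i<m. ip n (u i) z = 0"
    show "ip n z (mv n B z) \<le> ip n v (mv n B v) * ip n z z"
    proof (cases "\<exists>a<n. z a \<noteq> 0")
      case True
      then obtain x c where x: "x \<in> S" "c\<^sup>2 = ip n z z" "\<forall>a<n. z a = c * x a"
        using normalize[of z] z by blast
      have mvz: "mv n B z = (\<lambda>a. c * mv n B x a)"
        using x(3) mv_cong[of n z "\<lambda>a. c * x a" B] by (simp add: mv_scale)
      have "ip n z (mv n B z) = ip n (\<lambda>a. c * x a) (\<lambda>a. c * mv n B x a)"
        unfolding mvz by (rule ip_cong) (use x(3) in auto)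
      also have "\<dots> = ip n z z * ip n x (mv n B x)"
        unfolding ip_scale_left ip_scale_right x(2)[symmetric] power2_eq_square by (simp only: mult.assoc)
      also have "\<dots> \<le> ip n z z * ip n v (mv n B v)"
        using v(2)[OF x(1)] ip_self_nonneg by (rule mult_left_mono)
      finally show ?thesis by (simp add: mult.commute)
    next
      case False
      then show ?thesis by (simp add: ip_def)
    qed
  qed
qed

text \<open>The residual z = B v - l v of a maximizer v is orthogonal to the given eigenvectors, so
  v may be moved along z without leaving the complement. The form minus l times the squared norm
  then has slope 2 |z|^2 at v, and maximality forces z = 0. The bound by l is passed on because it
  orders the eigenvalues later.\<close>

lemma eigenvector_in_complement:
  assumes sym: "sym_on n B" and fam: "eigenfamily n B m u \<mu>" and "m < n"
  obtains v l where "ip n v v = 1" "\<And>i. i < m \<Longrightarrow> ip n (u i) v = 0"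
    "\<And>a. a < n \<Longrightarrow> mv n B v a = l * v a"
    "\<And>z. \<forall>i<m. ip n (u i) z = 0 \<Longrightarrow> ip n z (mv n B z) \<le> l * ip n z z"
proof -
  obtain v where v: "ip n v v = 1" "\<And>i. i < m \<Longrightarrow> ip n (u i) v = 0"
    "\<And>z. \<forall>i<m. ip n (u i) z = 0 \<Longrightarrow>
       ip n z (mv n B z) \<le> ip n v (mv n B v) * ip n z z"
    using \<open>m < n\<close> by (rule rayleigh_attained) (rule that)
  define l where "l = ip n v (mv n B v)"
  define z where "z = (\<lambda>a. mv n B v a - l * v a)"
  have z: "ip n (u i) z = 0" if "i < m" for i
  proof -
    have "ip n (u i) (mv n B v) = ip n (mv n B (u i)) v" by (rule ip_mv_sym[OF sym])
    also have "\<dots> = ip n (\<lambda>a. \<mu> i * u i a) v"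
      using fam that by (intro ip_cong) (auto simp: eigenfamily_def)
    finally show ?thesis
      using v(2)[OF that] by (simp add: z_def ip_diff_right ip_scale_right ip_scale_left)
  qed
  have "t * (2 * ip n z z) + t\<^sup>2 * (ip n z (mv n B z) - l * ip n z z) \<le> 0" for t
  proof -
    let ?y = "\<lambda>a. v a + t * z a"
    have "ip n ?y (mv n B ?y) \<le> l * ip n ?y ?y"
      unfolding l_def using v(2) z by (intro v(3)) (simp add: ip_add_right ip_scale_right)
    moreover have "ip n v (mv n B z) = ip n z (mv n B v)"
      by (subst ip_mv_sym[OF sym]) (rule ip_commute)
    ultimately have "l + 2 * t * ip n z (mv n B v) + t\<^sup>2 * ip n z (mv n B z)
        \<le> l * (1 + 2 * t * ip n z v + t\<^sup>2 * ip n z z)"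
      using v(1) by (simp add: mv_add mv_scale ip_add_left ip_add_right ip_scale_left ip_scale_right
          ip_commute[of n v z] l_def[symmetric] power2_eq_square algebra_simps)
    moreover have zz: "ip n z (mv n B v) = ip n z z + l * ip n z v"
      by (subst (3) z_def) (simp add: ip_diff_right ip_scale_right)
    ultimately show ?thesis unfolding zz by (simp add: algebra_simps)
  qed
  then have "2 * ip n z z = 0" by (rule linear_term_zero)
  then have "\<And>a. a < n \<Longrightarrow> mv n B v a = l * v a"
    by (simp add: ip_self_eq_0) (simp add: z_def)
  then show thesis
    using v by (intro that[of v l]) (auto simp: l_def)
qed

text \<open>
  Extending greedily by maximizers of the Rayleigh quotient yields the new eigenvalues in
  descending order.
\<close>

lemma eigenfamily_extend_sorted:
  assumes sym: "sym_on n B" and fam: "eigenfamily n B m u \<mu>"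
  obtains u' \<mu>' where "eigenfamily n B n u' \<mu>'"
    "\<And>i. i < m \<Longrightarrow> u' i = u i" "\<And>i. i < m \<Longrightarrow> \<mu>' i = \<mu> i"
    "\<And>i j. m \<le> i \<Longrightarrow> i \<le> j \<Longrightarrow> j < n \<Longrightarrow> \<mu>' j \<le> \<mu>' i"
proof -
  have "m \<le> n" using fam orthonormal_le_dim by (auto simp: eigenfamily_def)
  \<comment> \<open>The invariant records that each new \<open>\<mu>' i\<close> bounds the form on
    the complement of all earlier members. Every later member lies in that complement, which yields
    the descending order at the end.\<close>
  have "\<exists>u' \<mu>'. eigenfamily n B (m + d) u' \<mu>' \<and> (\<forall>i<m. u' i = u i \<and> \<mu>' i = \<mu> i) \<and>
      (\<forall>i. m \<le> i \<longrightarrow> i < m + d \<longrightarrow>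
        (\<forall>z. (\<forall>j<i. ip n (u' j) z = 0) \<longrightarrow> ip n z (mv n B z) \<le> \<mu>' i * ip n z z))"
    if "m + d \<le> n" for d
    using that
  proof (induction d)
    case 0
    show ?case using fam by (intro exI[of _ u] exI[of _ \<mu>]) auto
  next
    case (Suc d)
    from Suc.prems have "m + d \<le> n" by simp
    from Suc.IH[OF this] obtain u' \<mu>' where
      IH: "eigenfamily n B (m + d) u' \<mu>'" "\<forall>i<m. u' i = u i \<and> \<mu>' i = \<mu> i"
        "\<forall>i. m \<le> i \<longrightarrow> i < m + d \<longrightarrow>
          (\<forall>z. (\<forall>j<i. ip n (u' j) z = 0) \<longrightarrow> ip n z (mv n B z) \<le> \<mu>' i * ip n z z)"
      by (elim exE conjE) (rule that)
    have "m + d < n" using Suc.prems by simp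
    with sym IH(1) obtain v l where v: "ip n v v = 1" "\<And>i. i < m + d \<Longrightarrow> ip n (u' i) v = 0"
      "\<And>a. a < n \<Longrightarrow> mv n B v a = l * v a"
      "\<And>z. \<forall>i<m + d. ip n (u' i) z = 0 \<Longrightarrow> ip n z (mv n B z) \<le> l * ip n z z"
      by (rule eigenvector_in_complement) (rule that)
    let ?u = "u'(m + d := v)" and ?\<mu> = "\<mu>'(m + d := l)"
    have "eigenfamily n B (m + Suc d) ?u ?\<mu>"
      using IH(1) v(1-3) v(2)[unfolded ip_commute[of n _ v]]
      by (auto simp: eigenfamily_def orthonormal_def less_Suc_eq)
    moreover have "\<forall>i<m. ?u i = u i \<and> ?\<mu> i = \<mu> i" using IH(2) by auto
    moreover have "ip n z (mv n B z) \<le> ?\<mu> i * ip n z z"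
      if "m \<le> i" "i < m + Suc d" "\<forall>j<i. ip n (?u j) z = 0" for i z
    proof (cases "i = m + d")
      case True then show ?thesis using that v(4)[of z] by auto
    next
      case False
      then have "i < m + d" using that by simp
      then show ?thesis using that IH(3)[rule_format, of i z] by auto
    qed
    ultimately show ?case by (intro exI[of _ ?u] exI[of _ ?\<mu>]) blast
  qed
  from this[of "n - m"] \<open>m \<le> n\<close> have "\<exists>u' \<mu>'. eigenfamily n B n u' \<mu>' \<and> (\<forall>i<m. u' i = u i \<and> \<mu>' i = \<mu> i) \<and>
      (\<forall>i. m \<le> i \<longrightarrow> i < n \<longrightarrow> (\<forall>z. (\<forall>j<i. ip n (u' j) z = 0) \<longrightarrow> ip n z (mv n B z) \<le> \<mu>' i * ip n z z))"
    by simp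
  then obtain u' \<mu>' where
    *: "eigenfamily n B n u' \<mu>'" "\<forall>i<m. u' i = u i \<and> \<mu>' i = \<mu> i"
      "\<forall>i. m \<le> i \<longrightarrow> i < n \<longrightarrow> (\<forall>z. (\<forall>j<i. ip n (u' j) z = 0) \<longrightarrow> ip n z (mv n B z) \<le> \<mu>' i * ip n z z)"
    by (elim exE conjE) (rule that)
  show thesis
  proof (rule that[OF *(1)])
    fix i j assume ij: "m \<le> i" "i \<le> j" "j < n"
    have 1: "ip n (u' j) (u' j) = 1" "\<And>k. k < i \<Longrightarrow> ip n (u' k) (u' j) = 0"
      using *(1) ij by (auto simp: eigenfamily_def orthonormal_def)
    have "ip n (u' j) (mv n B (u' j)) = ip n (u' j) (\<lambda>a. \<mu>' j * u' j a)"
      using *(1) ij by (intro ip_cong) (auto simp: eigenfamily_def)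
    then show "\<mu>' j \<le> \<mu>' i"
      using *(3)[rule_format, of i "u' j"] ij 1 by (simp add: ip_scale_right)
  qed (use *(2) in auto)
qed

text \<open>
  Functional calculus: the matrix \<open>f(B)\<close> does not depend on the eigenbasis. For suitable \<open>f\<close> this
  covers positive parts, truncations at a spectral gap and (by traces) counting eigenvalues.
\<close>

lemma spectral_sum_unique:
  assumes sym: "sym_on n B" and u: "eigenfamily n B n u \<mu>" and v: "eigenfamily n B n v \<nu>"
    and "a < n" "b < n"
  shows "spectral_sum n u (\<lambda>i. f (\<mu> i)) a b = spectral_sum n v (\<lambda>i. f (\<nu> i)) a b"
proof -
  have on: "orthonormal n n u" "orthonormal n n v"
    using u v by (auto simp: eigenfamily_def)
  \<comment> \<open>Eigenvectors for different eigenvalues are orthogonal, so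
    \<open>ip n (u i) (v j)\<close> vanishes unless \<open>\<mu> i = \<nu> j\<close>; either
    eigenvalue may then be put under f.\<close>
  have key: "f (\<mu> i) * ip n (u i) (v j) = f (\<nu> j) * ip n (u i) (v j)" if "i < n" "j < n" for i j
  proof -
    have "\<nu> j * ip n (u i) (v j) = ip n (u i) (mv n B (v j))"
      using v that by (subst ip_scale_right[symmetric], intro ip_cong) (auto simp: eigenfamily_def)
    also have "\<dots> = ip n (mv n B (u i)) (v j)" by (rule ip_mv_sym[OF sym])
    also have "\<dots> = \<mu> i * ip n (u i) (v j)"
      using u that by (subst ip_scale_left[symmetric], intro ip_cong) (auto simp: eigenfamily_def)
    finally show ?thesis by auto
  qed
  have "spectral_sum n u (\<lambda>i. f (\<mu> i)) a b =
      (\<Sum>i<n. f (\<mu> i) * u i a * (\<Sum>j<n. ip n (v j) (u i) * v j b))"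
    unfolding spectral_sum_def using orthonormal_expansion[OF on(2) \<open>b < n\<close>] by simp
  also have "\<dots> = (\<Sum>i<n. \<Sum>j<n. (f (\<mu> i) * ip n (u i) (v j)) * (u i a * v j b))"
    by (simp add: sum_distrib_left ip_commute mult_ac)
  also have "\<dots> = (\<Sum>i<n. \<Sum>j<n. (f (\<nu> j) * ip n (u i) (v j)) * (u i a * v j b))"
    by (intro sum.cong refl) (simp add: key)
  also have "\<dots> = (\<Sum>j<n. f (\<nu> j) * (\<Sum>i<n. ip n (u i) (v j) * u i a) * v j b)"
    by (subst sum.swap) (simp add: sum_distrib_left sum_distrib_right mult_ac)
  also have "\<dots> = spectral_sum n v (\<lambda>i. f (\<nu> i)) a b"
    unfolding spectral_sum_def using orthonormal_expansion[OF on(1) \<open>a < n\<close>] by simp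
  finally show ?thesis .
qed

lemma spectral_decomposition:
  assumes u: "eigenfamily n B n u \<mu>" and "a < n" "b < n"
  shows "B a b = spectral_sum n u \<mu> a b"
proof -
  have on: "orthonormal n n u" using u by (auto simp: eigenfamily_def)
  have "B a b = (\<Sum>i<n. ip n (u i) (B a) * u i b)"
    by (rule orthonormal_expansion[OF on \<open>b < n\<close>])
  also have "\<dots> = (\<Sum>i<n. mv n B (u i) a * u i b)"
    by (simp add: ip_def mv_def mult.commute)
  also have "\<dots> = spectral_sum n u \<mu> a b"
    unfolding spectral_sum_def using u \<open>a < n\<close> by (intro sum.cong) (auto simp: eigenfamily_def)
  finally show ?thesis .
qed

section \<open>Action, trace and Frobenius norm of spectral sums\<close>

lemma mv_spectral_sum:
  "mv n (spectral_sum m u h) x a = (\<Sum>i<m. h i * ip n (u i) x * u i a)"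
  unfolding mv_def spectral_sum_def ip_def sum_distrib_right sum_distrib_left
  by (subst sum.swap) (simp add: mult_ac)

lemma mv_spectral_sum_basis:
  assumes "orthonormal n m u" "j < m"
  shows "mv n (spectral_sum m u h) (u j) a = h j * u j a"
proof -
  have "mv n (spectral_sum m u h) (u j) a = (\<Sum>i<m. if i = j then h i * u i a else 0)"
    unfolding mv_spectral_sum using assms by (intro sum.cong) (auto simp: orthonormal_def)
  then show ?thesis using assms by simp
qed

lemma trace_spectral_sum:
  assumes "orthonormal n m u"
  shows "(\<Sum>a<n. spectral_sum m u h a a) = (\<Sum>i<m. h i)"
proof -
  have "(\<Sum>a<n. spectral_sum m u h a a) = (\<Sum>i<m. h i * ip n (u i) (u i))"
    unfolding spectral_sum_def ip_def sum_distrib_left by (subst sum.swap) (simp add: mult_ac)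
  then show ?thesis using assms by (simp add: orthonormal_def)
qed

lemma frobenius_spectral_sum:
  assumes "orthonormal n m u"
  shows "(\<Sum>a<n. \<Sum>b<n. (spectral_sum m u h a b)\<^sup>2) = (\<Sum>i<m. (h i)\<^sup>2)"
proof -
  let ?S = "spectral_sum m u h"
  have row: "(\<Sum>b<n. (?S a b)\<^sup>2) = (\<Sum>i<m. (h i)\<^sup>2 * (u i a * u i a))" for a
  proof -
    have "(\<Sum>b<n. (?S a b)\<^sup>2) = (\<Sum>b<n. ?S a b * (\<Sum>i<m. h i * u i a * u i b))"
      by (simp only: power2_eq_square spectral_sum_def)
    also have "\<dots> = (\<Sum>i<m. \<Sum>b<n. ?S a b * (h i * u i a * u i b))"
      unfolding sum_distrib_left by (rule sum.swap)
    also have "\<dots> = (\<Sum>i<m. h i * u i a * mv n ?S (u i) a)"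
      by (simp only: mv_def sum_distrib_left mult_ac)
    also have "\<dots> = (\<Sum>i<m. (h i)\<^sup>2 * (u i a * u i a))"
      by (intro sum.cong refl)
        (simp add: mv_spectral_sum_basis[OF assms] power2_eq_square)
    finally show ?thesis .
  qed
  have "(\<Sum>a<n. \<Sum>b<n. (?S a b)\<^sup>2) = (\<Sum>i<m. (h i)\<^sup>2 * ip n (u i) (u i))"
    unfolding row ip_def sum_distrib_left by (rule sum.swap)
  then show ?thesis using assms by (simp add: orthonormal_def)
qed

section \<open>Best approximation by Gram matrices\<close>

definition gram :: "nat \<Rightarrow> (nat \<Rightarrow> nat \<Rightarrow> real) \<Rightarrow> nat \<Rightarrow> nat \<Rightarrow> real" where
  "gram K V a b = (\<Sum>k<K. V k a * V k b)"

definition gram_loss :: "nat \<Rightarrow> nat \<Rightarrow> (nat \<Rightarrow> nat \<Rightarrow> real) \<Rightarrow> (nat \<Rightarrow> nat \<Rightarrow> real) \<Rightarrow> real" where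
  "gram_loss n K B V = (\<Sum>a<n. \<Sum>b<n. (gram K V a b - B a b)\<^sup>2)"

lemma gram_commute: "gram K V a b = gram K V b a"
  by (simp add: gram_def mult.commute)

lemma mv_gram: "mv n (gram K V) x a = (\<Sum>k<K. ip n (V k) x * V k a)"
  unfolding mv_def gram_def ip_def sum_distrib_right by (subst sum.swap) (simp only: mult_ac)

lemma ip_mv_gram: "ip n x (mv n (gram K V) y) = (\<Sum>k<K. ip n (V k) x * ip n (V k) y)"
  unfolding mv_gram ip_sum_right ip_scale_right by (simp add: ip_commute mult.commute)

lemma mv_sum: "mv n B (\<lambda>a. \<Sum>k<K. c k * f k a) a = (\<Sum>k<K. c k * mv n B (f k) a)"
  unfolding mv_def sum_distrib_left by (subst sum.swap) (simp only: mult_ac)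

text \<open>
  With \<open>R = V\<^sup>T V - B\<close>, the first variation in the direction \<open>E = V R\<close> is \<open>4 |V R|\<^sup>2\<close>, so \<open>V R = 0\<close>.
\<close>

lemma gram_loss_stationary:
  assumes sym: "sym_on n B" and min: "\<And>V'. gram_loss n K B V \<le> gram_loss n K B V'"
    and "k < K" "b < n"
  shows "mv n B (V k) b = mv n (gram K V) (V k) b"
proof -
  define R where "R a b = gram K V a b - B a b" for a b
  define E where "E k a = (\<Sum>c<n. V k c * R c a)" for k a
  \<comment> \<open>The first-order term V^T E + E^T V of the Gram matrix along V + t E.\<close>
  define P where "P a b = (\<Sum>k<K. V k a * E k b + E k a * V k b)" for a b
  have R_sym: "R a b = R b a" if "a < n" "b < n" for a b
    using sym that by (simp add: R_def gram_commute[of K V a] sym_on_def)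
  have expand: "gram_loss n K B (\<lambda>k a. V k a + t * E k a) =
      (\<Sum>a<n. \<Sum>b<n. (R a b + t * P a b + t\<^sup>2 * gram K E a b)\<^sup>2)" for t
  proof -
    have "gram K (\<lambda>k a. V k a + t * E k a) a b =
        gram K V a b + t * P a b + t\<^sup>2 * gram K E a b" for a b
      by (simp add: gram_def P_def sum_distrib_left flip: sum.distrib)
        (simp add: algebra_simps power2_eq_square)
    then show ?thesis by (simp add: gram_loss_def R_def algebra_simps)
  qed
  have deriv: "((\<lambda>t. \<Sum>a<n. \<Sum>b<n. (R a b + t * P a b + t\<^sup>2 * gram K E a b)\<^sup>2)
      has_real_derivative (\<Sum>a<n. \<Sum>b<n. 2 * R a b * P a b)) (at 0)"
    by (intro DERIV_sum) (auto intro!: derivative_eq_intros)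
  have "(\<Sum>a<n. \<Sum>b<n. 2 * R a b * P a b) = 0"
  proof (rule DERIV_local_min[OF deriv, of 1], simp, intro allI impI)
    fix t :: real
    show "(\<Sum>a<n. \<Sum>b<n. (R a b + 0 * P a b + 0\<^sup>2 * gram K E a b)\<^sup>2)
      \<le> (\<Sum>a<n. \<Sum>b<n. (R a b + t * P a b + t\<^sup>2 * gram K E a b)\<^sup>2)"
      using min unfolding expand[symmetric] by simp
  qed
  \<comment> \<open>R is symmetric, so both summands of P contribute equally, and summing over the
    index of V first turns each into |E|^2.\<close>
  moreover have "(\<Sum>a<n. \<Sum>b<n. 2 * R a b * P a b) = 4 * (\<Sum>k<K. \<Sum>b<n. (E k b)\<^sup>2)"
  proof -
    have 1: "(\<Sum>a<n. \<Sum>b<n. R a b * (\<Sum>k<K. V k a * E k b)) = (\<Sum>k<K. \<Sum>b<n. (E k b)\<^sup>2)"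
    proof -
      have "(\<Sum>a<n. \<Sum>b<n. R a b * (\<Sum>k<K. V k a * E k b)) =
          (\<Sum>a<n. \<Sum>k<K. \<Sum>b<n. E k b * (V k a * R a b))"
        unfolding sum_distrib_left by (subst (2) sum.swap) (simp only: mult_ac)
      also have "\<dots> = (\<Sum>k<K. \<Sum>a<n. \<Sum>b<n. E k b * (V k a * R a b))"
        by (rule sum.swap)
      also have "\<dots> = (\<Sum>k<K. \<Sum>b<n. E k b * (\<Sum>a<n. V k a * R a b))"
        unfolding sum_distrib_left by (intro sum.cong refl sum.swap)
      finally show ?thesis by (simp add: E_def power2_eq_square)
    qed
    have 2: "(\<Sum>a<n. \<Sum>b<n. R a b * (\<Sum>k<K. E k a * V k b)) =
        (\<Sum>a<n. \<Sum>b<n. R a b * (\<Sum>k<K. V k a * E k b))"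
      by (subst sum.swap) (intro sum.cong refl, simp add: R_sym mult.commute)
    have "(\<Sum>a<n. \<Sum>b<n. 2 * R a b * P a b) =
        2 * ((\<Sum>a<n. \<Sum>b<n. R a b * (\<Sum>k<K. V k a * E k b)) +
             (\<Sum>a<n. \<Sum>b<n. R a b * (\<Sum>k<K. E k a * V k b)))"
      by (simp only: P_def sum.distrib distrib_left sum_distrib_left[of 2] mult.assoc)
    then show ?thesis unfolding 2 1 by simp
  qed
  ultimately have "(\<Sum>k<K. \<Sum>b<n. (E k b)\<^sup>2) = 0" by simp
  then have "E k b = 0"
    using \<open>k < K\<close> \<open>b < n\<close> by (simp add: sum_nonneg_eq_0_iff sum_nonneg)
  moreover have "E k b = mv n (gram K V) (V k) b - mv n B (V k) b"
  proof -
    have "E k b = (\<Sum>c<n. R b c * V k c)"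
      unfolding E_def using \<open>b < n\<close> by (intro sum.cong refl) (simp add: R_sym[of _ b])
    then show ?thesis by (simp add: R_def mv_def left_diff_distrib sum_subtractf)
  qed
  ultimately show ?thesis by simp
qed

text \<open>G - B has eigenvalue 0 on T and \<open>- \<mu> l\<close> off T, so the loss is the sum
  of the squares of the dropped eigenvalues. It is written as total minus kept so that the total
  cancels when two sets T are compared.\<close>

lemma gram_loss_spectral:
  assumes "eigenfamily n B n u \<mu>" "T \<subseteq> {..<n}"
    and "\<And>a b. a < n \<Longrightarrow> b < n \<Longrightarrow> gram K V a b = (\<Sum>l\<in>T. \<mu> l * u l a * u l b)"
  shows "gram_loss n K B V = (\<Sum>l<n. (\<mu> l)\<^sup>2) - (\<Sum>l\<in>T. (\<mu> l)\<^sup>2)"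
proof -
  let ?h = "\<lambda>l. if l \<in> T then 0 else - \<mu> l"
  have T: "(\<Sum>l\<in>T. g l) = (\<Sum>l<n. if l \<in> T then g l else 0)" for g :: "nat \<Rightarrow> real"
    using assms(2) by (simp add: sum.inter_restrict[symmetric] Int_absorb1)
  have "gram K V a b - B a b = spectral_sum n u ?h a b" if "a < n" "b < n" for a b
    using that unfolding spectral_decomposition[OF assms(1) that] assms(3)[OF that] T spectral_sum_def
    by (auto simp: sum_subtractf[symmetric] intro!: sum.cong)
  then have "gram_loss n K B V = (\<Sum>a<n. \<Sum>b<n. (spectral_sum n u ?h a b)\<^sup>2)"
    by (simp add: gram_loss_def)
  also have "\<dots> = (\<Sum>l<n. (?h l)\<^sup>2)"
    using assms(1) by (intro frobenius_spectral_sum) (simp add: eigenfamily_def)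
  also have "\<dots> = (\<Sum>l<n. (\<mu> l)\<^sup>2) - (\<Sum>l\<in>T. (\<mu> l)\<^sup>2)"
    unfolding T sum_subtractf[symmetric] by (intro sum.cong) auto
  finally show ?thesis .
qed

lemma gram_realize_spectral:
  assumes "finite T" "card T \<le> K" "\<And>l. l \<in> T \<Longrightarrow> 0 \<le> \<mu> l"
  obtains V where "\<And>a b. gram K V a b = (\<Sum>l\<in>T. \<mu> l * u l a * u l b)"
proof -
  obtain f where f: "bij_betw f {..<card T} T"
    using ex_bij_betw_nat_finite[OF assms(1)] by (auto simp: lessThan_atLeast0)
  define V where "V k a = (if k < card T then sqrt (\<mu> (f k)) * u (f k) a else 0)" for k a
  have "gram K V a b = (\<Sum>l\<in>T. \<mu> l * u l a * u l b)" for a b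
  proof -
    have "gram K V a b = (\<Sum>k<card T. V k a * V k b)"
      unfolding gram_def using assms(2) by (intro sum.mono_neutral_right) (auto simp: V_def)
    also have "\<dots> = (\<Sum>k<card T. \<mu> (f k) * u (f k) a * u (f k) b)"
    proof (intro sum.cong refl)
      fix k assume "k \<in> {..<card T}"
      then have "0 \<le> \<mu> (f k)" "k < card T"
        using f assms(3) by (auto simp: bij_betw_def)
      have "V k a * V k b = (sqrt (\<mu> (f k)) * sqrt (\<mu> (f k))) * u (f k) a * u (f k) b"
        using \<open>k < card T\<close> by (simp add: V_def)
      then show "V k a * V k b = \<mu> (f k) * u (f k) a * u (f k) b"
        using \<open>0 \<le> \<mu> (f k)\<close> by simp
    qed
    also have "\<dots> = (\<Sum>l\<in>T. \<mu> l * u l a * u l b)"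
      by (rule sum.reindex_bij_betw[OF f])
    finally show ?thesis .
  qed
  then show thesis by (rule that)
qed

text \<open>B and G agree on the rows of V and hence on their span, which contains every eigenvector
  of G with nonzero eigenvalue. These are therefore shared eigenvectors, and an eigenbasis of B can
  start with them. The descending order is obtained only within the two blocks; that the kept
  eigenvalues dominate takes a comparison of losses.\<close>

lemma gram_minimizer_commutes:
  assumes sym: "sym_on n B" and min: "\<And>V'. gram_loss n K B V \<le> gram_loss n K B V'"
  obtains u \<mu> r where "eigenfamily n B n u \<mu>" "r \<le> K" "r \<le> n" "\<And>i. i < r \<Longrightarrow> 0 < \<mu> i"
    "\<And>i j. i \<le> j \<Longrightarrow> j < r \<Longrightarrow> \<mu> j \<le> \<mu> i"
    "\<And>i j. r \<le> i \<Longrightarrow> i \<le> j \<Longrightarrow> j < n \<Longrightarrow> \<mu> j \<le> \<mu> i"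
    "\<And>a b. a < n \<Longrightarrow> b < n \<Longrightarrow> gram K V a b = spectral_sum r u \<mu> a b"
proof -
  let ?G = "gram K V"
  have G_sym: "sym_on n ?G" by (simp add: sym_on_def gram_commute)
  \<comment> \<open>Extending the empty family yields a full eigenbasis of G in descending
    order.\<close>
  have "eigenfamily n ?G 0 undefined undefined" by (simp add: eigenfamily_def orthonormal_def)
  with G_sym obtain g \<gamma> where g: "eigenfamily n ?G n g \<gamma>"
    and \<gamma>: "\<And>i j. i \<le> j \<Longrightarrow> j < n \<Longrightarrow> \<gamma> j \<le> \<gamma> i"
    by (rule eigenfamily_extend_sorted) (rule that, auto)
  have g_on: "orthonormal n n g" and g_eig: "\<And>i a. i < n \<Longrightarrow> a < n \<Longrightarrow> mv n ?G (g i) a = \<gamma> i * g i a"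
    using g by (auto simp: eigenfamily_def)
  \<comment> \<open>The vectors V g_i are pairwise orthogonal with squared length
    \<open>\<gamma> i\<close>; this makes the eigenvalues nonnegative and later bounds the rank by
    K.\<close>
  have form: "(\<Sum>k<K. ip n (V k) (g i) * ip n (V k) (g j)) = (if i = j then \<gamma> j else 0)"
    if "i < n" "j < n" for i j
  proof -
    have "(\<Sum>k<K. ip n (V k) (g i) * ip n (V k) (g j)) = ip n (g i) (mv n ?G (g j))"
      by (rule ip_mv_gram[symmetric])
    also have "\<dots> = ip n (g i) (\<lambda>a. \<gamma> j * g j a)"
      using that g_eig by (intro ip_cong) auto
    finally show ?thesis using that g_on by (simp add: ip_scale_right orthonormal_def)
  qed
  have \<gamma>_nonneg: "0 \<le> \<gamma> i" if "i < n" for i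
  proof -
    have "0 \<le> (\<Sum>k<K. ip n (V k) (g i) * ip n (V k) (g i))" by (intro sum_nonneg) simp
    then show ?thesis using form[OF that that] by simp
  qed
  \<comment> \<open>The rank of G. The guard \<open>i < n\<close> makes \<open>n\<close> a
    candidate, so that \<open>r = n\<close> when all eigenvalues are positive.\<close>
  define r where "r = (LEAST i. i < n \<longrightarrow> \<gamma> i \<le> 0)"
  have "r \<le> n" unfolding r_def by (rule Least_le) simp
  have pos: "0 < \<gamma> i" if "i < r" for i
    using not_less_Least[OF that[unfolded r_def]] by simp
  have zero: "\<gamma> i = 0" if "r \<le> i" "i < n" for i
  proof -
    have "r < n \<longrightarrow> \<gamma> r \<le> 0" unfolding r_def by (rule LeastI[of _ n]) simp
    then show ?thesis using that \<gamma>[of r i] \<gamma>_nonneg[of i] by simp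
  qed
  \<comment> \<open>The multiple of \<open>g i\<close> by \<open>\<gamma> i\<close> is V^T (V g_i),
    a combination of the rows of V with coefficients \<open>?c\<close>, to which stationarity
    applies; \<open>\<gamma> i\<close> is positive and can be cancelled.\<close>
  have B_eig: "mv n B (g i) a = \<gamma> i * g i a" if "i < r" "a < n" for i a
  proof -
    let ?c = "\<lambda>k. ip n (V k) (g i)"
    have "i < n" using that \<open>r \<le> n\<close> by simp
    have *: "mv n M (\<lambda>a. \<Sum>k<K. ?c k * V k a) = (\<lambda>a. \<gamma> i * mv n M (g i) a)" for M
      unfolding mv_gram[symmetric] mv_scale[symmetric]
      using g_eig[OF \<open>i < n\<close>] by (rule mv_cong)
    have "\<gamma> i * mv n B (g i) a = (\<Sum>k<K. ?c k * mv n B (V k) a)"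
      unfolding mv_sum[symmetric] * ..
    also have "\<dots> = (\<Sum>k<K. ?c k * mv n ?G (V k) a)"
      using \<open>a < n\<close> by (simp add: gram_loss_stationary[OF sym min])
    also have "\<dots> = \<gamma> i * mv n ?G (g i) a"
      unfolding mv_sum[symmetric] * ..
    finally show ?thesis using pos[OF \<open>i < r\<close>] g_eig[OF \<open>i < n\<close> \<open>a < n\<close>] by simp
  qed
  have "eigenfamily n B r g \<gamma>"
    using g_on B_eig \<open>r \<le> n\<close> by (auto simp: eigenfamily_def orthonormal_def)
  with sym obtain u \<mu> where u: "eigenfamily n B n u \<mu>"
    "\<And>i. i < r \<Longrightarrow> u i = g i" "\<And>i. i < r \<Longrightarrow> \<mu> i = \<gamma> i"
    "\<And>i j. r \<le> i \<Longrightarrow> i \<le> j \<Longrightarrow> j < n \<Longrightarrow> \<mu> j \<le> \<mu> i"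
    by (rule eigenfamily_extend_sorted) (rule that)
  \<comment> \<open>The normalized images V g_i are r orthonormal vectors of length K.\<close>
  have "orthonormal K r (\<lambda>i k. ip n (V k) (g i) / sqrt (\<gamma> i))"
    unfolding orthonormal_def
  proof (intro allI impI)
    fix i j assume ij: "i < r" "j < r"
    have "ip K (\<lambda>k. ip n (V k) (g i) / sqrt (\<gamma> i)) (\<lambda>k. ip n (V k) (g j) / sqrt (\<gamma> j)) =
        (\<Sum>k<K. ip n (V k) (g i) * ip n (V k) (g j)) / (sqrt (\<gamma> i) * sqrt (\<gamma> j))"
      by (simp add: ip_def[of K] sum_divide_distrib)
    then show "ip K (\<lambda>k. ip n (V k) (g i) / sqrt (\<gamma> i)) (\<lambda>k. ip n (V k) (g j) / sqrt (\<gamma> j)) =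
        (if i = j then 1 else 0)"
      using ij \<open>r \<le> n\<close> pos[OF ij(1)] pos[OF ij(2)] by (auto simp: form)
  qed
  then have "r \<le> K" by (rule orthonormal_le_dim)
  have "?G a b = spectral_sum r u \<mu> a b" if "a < n" "b < n" for a b
  proof -
    have "?G a b = spectral_sum n g \<gamma> a b" by (rule spectral_decomposition[OF g that])
    also have "\<dots> = spectral_sum r g \<gamma> a b"
      unfolding spectral_sum_def using \<open>r \<le> n\<close> zero by (intro sum.mono_neutral_right) auto
    also have "\<dots> = spectral_sum r u \<mu> a b"
      unfolding spectral_sum_def using u by (intro sum.cong) auto
    finally show ?thesis .
  qed
  moreover have "\<mu> j \<le> \<mu> i" if "i \<le> j" "j < r" for i j
    using that \<gamma>[of i j] u(3) \<open>r \<le> n\<close> by simp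
  ultimately show thesis
    using u pos \<open>r \<le> K\<close> \<open>r \<le> n\<close> by (intro that[of u \<mu> r]) auto
qed

text \<open>The kept set has the largest sum of squares among sets of at most K nonnegative
  eigenvalues. Exchanging a kept index for a dropped one with larger eigenvalue would raise this
  sum, and so would adding a positive eigenvalue while a row is still free.\<close>

lemma gram_minimizer_truncation:
  assumes sym: "sym_on n B" and min: "\<And>V'. gram_loss n K B V \<le> gram_loss n K B V'"
  obtains u \<mu> r where "eigenfamily n B n u \<mu>" "r \<le> K" "r \<le> n" "\<And>i. i < r \<Longrightarrow> 0 < \<mu> i"
    "\<And>i j. i \<le> j \<Longrightarrow> j < n \<Longrightarrow> \<mu> j \<le> \<mu> i"
    "\<And>i. r < K \<Longrightarrow> r \<le> i \<Longrightarrow> i < n \<Longrightarrow> \<mu> i \<le> 0"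
    "\<And>a b. a < n \<Longrightarrow> b < n \<Longrightarrow> gram K V a b = spectral_sum r u \<mu> a b"
proof -
  obtain u \<mu> r where u: "eigenfamily n B n u \<mu>" "r \<le> K" "r \<le> n" "\<And>i. i < r \<Longrightarrow> 0 < \<mu> i"
    "\<And>i j. i \<le> j \<Longrightarrow> j < r \<Longrightarrow> \<mu> j \<le> \<mu> i"
    "\<And>i j. r \<le> i \<Longrightarrow> i \<le> j \<Longrightarrow> j < n \<Longrightarrow> \<mu> j \<le> \<mu> i"
    "\<And>a b. a < n \<Longrightarrow> b < n \<Longrightarrow> gram K V a b = spectral_sum r u \<mu> a b"
    using sym min by (rule gram_minimizer_commutes) (rule that)
  have loss: "gram_loss n K B V = (\<Sum>l<n. (\<mu> l)\<^sup>2) - (\<Sum>l<r. (\<mu> l)\<^sup>2)"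
    using u(3,7) by (intro gram_loss_spectral[OF u(1)]) (auto simp: spectral_sum_def)
  have compare: "(\<Sum>l\<in>T. (\<mu> l)\<^sup>2) \<le> (\<Sum>l<r. (\<mu> l)\<^sup>2)"
    if T: "T \<subseteq> {..<n}" "card T \<le> K" "\<And>l. l \<in> T \<Longrightarrow> 0 \<le> \<mu> l" for T
  proof -
    have "finite T" using T(1) by (rule finite_subset) simp
    then obtain V' where V': "\<And>a b. gram K V' a b = (\<Sum>l\<in>T. \<mu> l * u l a * u l b)"
      using T(2) by (rule gram_realize_spectral[where u = u and \<mu> = \<mu>]) (rule T(3), assumption, rule that)
    have "gram_loss n K B V' = (\<Sum>l<n. (\<mu> l)\<^sup>2) - (\<Sum>l\<in>T. (\<mu> l)\<^sup>2)"
      by (rule gram_loss_spectral[OF u(1) T(1) V'])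
    then show ?thesis using min[of V'] loss by simp
  qed
  have swap: "\<mu> i \<le> \<mu> j" if "j < r" "r \<le> i" "i < n" for i j
  proof (rule ccontr)
    assume less: "\<not> \<mu> i \<le> \<mu> j"
    let ?T = "insert i ({..<r} - {j})"
    have "0 < \<mu> j" using u(4) that by simp
    have "(\<Sum>l\<in>?T. (\<mu> l)\<^sup>2) \<le> (\<Sum>l<r. (\<mu> l)\<^sup>2)"
    proof (rule compare)
      show "?T \<subseteq> {..<n}" using that u(3) by auto
      show "card ?T \<le> K" using that u(2) by simp
      show "0 \<le> \<mu> l" if "l \<in> ?T" for l using that u(4)[of l] less \<open>0 < \<mu> j\<close> by auto
    qed
    moreover have "(\<Sum>l\<in>?T. (\<mu> l)\<^sup>2) = (\<mu> i)\<^sup>2 + ((\<Sum>l<r. (\<mu> l)\<^sup>2) - (\<mu> j)\<^sup>2)"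
      using that by (simp add: sum_diff1)
    moreover have "(\<mu> j)\<^sup>2 < (\<mu> i)\<^sup>2"
      using less \<open>0 < \<mu> j\<close> by (intro power_strict_mono) auto
    ultimately show False by simp
  qed
  have "\<mu> i \<le> 0" if "r < K" "r \<le> i" "i < n" for i
  proof (rule ccontr)
    assume pos: "\<not> \<mu> i \<le> 0"
    have "(\<Sum>l\<in>insert i {..<r}. (\<mu> l)\<^sup>2) \<le> (\<Sum>l<r. (\<mu> l)\<^sup>2)"
    proof (rule compare)
      show "insert i {..<r} \<subseteq> {..<n}" using that u(3) by auto
      show "card (insert i {..<r}) \<le> K" using that by simp
      show "0 \<le> \<mu> l" if "l \<in> insert i {..<r}" for l using that u(4)[of l] pos by auto
    qed
    then show False using that pos by simp
  qed
  moreover have "\<mu> j \<le> \<mu> i" if "i \<le> j" "j < n" for i j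
    using that u(5)[of i j] u(6)[of i j] swap[of i j] by (cases "j < r"; cases "r \<le> i") auto
  ultimately show thesis
    using u(1-4,7) by (intro that[of u \<mu> r])
qed

section \<open>Matrices over the kernel\<close>

abbreviation (input) entries :: "real mat \<Rightarrow> nat \<Rightarrow> nat \<Rightarrow> real" where
  "entries M \<equiv> \<lambda>a b. M $$ (a, b)"

lemma mult_mat_vec_mv:
  assumes "M \<in> carrier_mat m n" "v \<in> carrier_vec n" "a < m"
  shows "(M *\<^sub>v v) $ a = mv n (entries M) (($) v) a"
  using assms by (simp add: scalar_prod_def mv_def lessThan_atLeast0)

lemma mult_mat_entry:
  assumes "A \<in> carrier_mat m p" "B \<in> carrier_mat p q" "a < m" "b < q"
  shows "(A * B) $$ (a, b) = (\<Sum>i<p. A $$ (a, i) * B $$ (i, b))"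
  using assms by (simp add: scalar_prod_def lessThan_atLeast0)

lemma scalar_prod_ip: "w \<in> carrier_vec n \<Longrightarrow> scalar_prod v w = ip n (($) v) (($) w)"
  by (simp add: scalar_prod_def ip_def lessThan_atLeast0)

lemma mv_one_plus:
  assumes "A \<in> carrier_mat n n" "a < n"
  shows "mv n (entries (1\<^sub>m n + A)) u a = u a + mv n (entries A) u a"
proof -
  have "mv n (entries (1\<^sub>m n + A)) u a = (\<Sum>b<n. (if b = a then u b else 0) + A $$ (a, b) * u b)"
    unfolding mv_def using assms by (intro sum.cong refl) (auto simp: distrib_right)
  then show ?thesis using assms by (simp add: sum.distrib mv_def)
qed

lemma adjacency_sym_on:
  assumes "adjacency_matrix N A"
  shows "sym_on N (entries (1\<^sub>m N + A))"
proof -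
  have A: "A \<in> carrier_mat N N" and "transpose_mat A = A"
    using assms by (auto simp: adjacency_matrix_def)
  have "A $$ (a, b) = A $$ (b, a)" if "a < N" "b < N" for a b
    using A that index_transpose_mat(1)[of b A a] \<open>transpose_mat A = A\<close> by simp
  then show ?thesis using A by (auto simp: sym_on_def)
qed

text \<open>Passes from the vectors in the definition of the positive part to function families:
  \<open>A\<close> and \<open>I + A\<close> have the same eigenvectors, with eigenvalues shifted by
  1.\<close>

lemma orthonormal_eigenbasis_iff:
  assumes A: "A \<in> carrier_mat N N"
  shows "orthonormal_eigenbasis N A v e \<longleftrightarrow> (\<forall>i<N. v i \<in> carrier_vec N) \<and>
    eigenfamily N (entries (1\<^sub>m N + A)) N (\<lambda>i. ($) (v i)) (\<lambda>i. e i + 1)"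
proof -
  have eig: "(\<forall>a<N. mv N (entries (1\<^sub>m N + A)) (($) (v i)) a = (e i + 1) * v i $ a) \<longleftrightarrow>
      A *\<^sub>v v i = e i \<cdot>\<^sub>v v i" if "v i \<in> carrier_vec N" for i
  proof -
    have "A *\<^sub>v v i = e i \<cdot>\<^sub>v v i \<longleftrightarrow> (\<forall>a<N. mv N (entries A) (($) (v i)) a = e i * v i $ a)"
      using A that mult_mat_vec_mv[OF A that]
      by (auto simp: vec_eq_iff simp del: index_mult_mat_vec)
    then show ?thesis
      using A by (simp add: mv_one_plus distrib_right)
  qed
  \<comment> \<open>Unit length supplies the nonzero condition in
    \<open>eigenvector\<close>.\<close>
  have nz: "v i \<noteq> 0\<^sub>v N" if "scalar_prod (v i) (v i) = 1" for i
    using that by (auto simp: scalar_prod_def)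
  show ?thesis
  proof (intro iffI conjI)
    assume "orthonormal_eigenbasis N A v e"
    then have c: "\<And>i. i < N \<Longrightarrow> v i \<in> carrier_vec N"
      and Av: "\<And>i. i < N \<Longrightarrow> A *\<^sub>v v i = e i \<cdot>\<^sub>v v i"
      and on: "\<And>i j. i < N \<Longrightarrow> j < N \<Longrightarrow> scalar_prod (v i) (v j) = (if i = j then 1 else 0)"
      using A unfolding orthonormal_eigenbasis_def eigenvector_def by blast+
    show "\<forall>i<N. v i \<in> carrier_vec N" using c by blast
    show "eigenfamily N (entries (1\<^sub>m N + A)) N (\<lambda>i. ($) (v i)) (\<lambda>i. e i + 1)"
      unfolding eigenfamily_def orthonormal_def
      using eig[OF c] Av on by (simp add: c flip: scalar_prod_ip)
  next
    assume *: "(\<forall>i<N. v i \<in> carrier_vec N) \<and>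
      eigenfamily N (entries (1\<^sub>m N + A)) N (\<lambda>i. ($) (v i)) (\<lambda>i. e i + 1)"
    then have c: "\<And>i. i < N \<Longrightarrow> v i \<in> carrier_vec N" by blast
    have on: "scalar_prod (v i) (v j) = (if i = j then 1 else 0)" if "i < N" "j < N" for i j
      using * that unfolding eigenfamily_def orthonormal_def scalar_prod_ip[OF c[OF \<open>j < N\<close>]] by blast
    have "A *\<^sub>v v i = e i \<cdot>\<^sub>v v i" if "i < N" for i
      unfolding eig[OF c[OF that], symmetric] using * that by (simp add: eigenfamily_def)
    then show "orthonormal_eigenbasis N A v e"
      using A c on nz by (auto simp: orthonormal_eigenbasis_def eigenvector_def)
  qed
qed

text \<open>The definite description is well defined: an eigenbasis of \<open>I + A\<close> with
  eigenvalues shifted back by 1 is a witness, and every other one gives the same matrix f(I + A)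
  with f(t) = max(t, 0).\<close>

lemma pos_part_I_plus_eq:
  assumes A: "A \<in> carrier_mat N N" and sym: "sym_on N (entries (1\<^sub>m N + A))"
    and u: "eigenfamily N (entries (1\<^sub>m N + A)) N u \<mu>"
  shows "pos_part_I_plus N A = mat N N (\<lambda>(a, b). spectral_sum N u (\<lambda>i. max (\<mu> i) 0) a b)"
  unfolding pos_part_I_plus_def
proof (rule the_equality)
  have "eigenfamily N (entries (1\<^sub>m N + A)) N (\<lambda>i. ($) (vec N (u i))) (\<lambda>i. (\<mu> i - 1) + 1)"
  proof -
    have "mv N B (($) (vec N (u i))) = mv N B (u i)" for B i by (rule mv_cong) simp
    moreover have "ip N (($) (vec N (u i))) (($) (vec N (u j))) = ip N (u i) (u j)" for i j
      by (rule ip_cong) simp_all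
    ultimately show ?thesis using u by (simp add: eigenfamily_def orthonormal_def)
  qed
  then have "orthonormal_eigenbasis N A (\<lambda>i. vec N (u i)) (\<lambda>i. \<mu> i - 1)"
    by (simp add: orthonormal_eigenbasis_iff[OF A])
  moreover have "mat N N (\<lambda>(a, b). spectral_sum N u (\<lambda>i. max (\<mu> i) 0) a b) =
      mat N N (\<lambda>(a, b). \<Sum>i<N. max ((\<mu> i - 1) + 1) 0 * (vec N (u i) $ a * vec N (u i) $ b))"
    by (rule eq_matI) (simp_all add: spectral_sum_def mult.assoc)
  ultimately show "\<exists>v e. orthonormal_eigenbasis N A v e \<and>
      mat N N (\<lambda>(a, b). spectral_sum N u (\<lambda>i. max (\<mu> i) 0) a b) =
      mat N N (\<lambda>(a, b). \<Sum>i<N. max (e i + 1) 0 * (v i $ a * v i $ b))"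
    by (intro exI conjI)
next
  fix P
  assume "\<exists>v e. orthonormal_eigenbasis N A v e \<and>
    P = mat N N (\<lambda>(a, b). \<Sum>i<N. max (e i + 1) 0 * (v i $ a * v i $ b))"
  then obtain v e where v: "orthonormal_eigenbasis N A v e"
    and P: "P = mat N N (\<lambda>(a, b). \<Sum>i<N. max (e i + 1) 0 * (v i $ a * v i $ b))"
    by (elim exE conjE) (rule that)
  have "eigenfamily N (entries (1\<^sub>m N + A)) N (\<lambda>i. ($) (v i)) (\<lambda>i. e i + 1)"
    using v by (simp add: orthonormal_eigenbasis_iff[OF A])
  note * = spectral_sum_unique[OF sym this u, where f = "\<lambda>t. max t 0"]
  show "P = mat N N (\<lambda>(a, b). spectral_sum N u (\<lambda>i. max (\<mu> i) 0) a b)"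
    unfolding P
  proof (rule eq_matI; simp)
    fix a b assume ab: "a < N" "b < N"
    have "(\<Sum>i<N. max (e i + 1) 0 * (v i $ a * v i $ b)) =
        spectral_sum N (\<lambda>i. ($) (v i)) (\<lambda>i. max (e i + 1) 0) a b"
      by (simp add: spectral_sum_def mult.assoc)
    then show "(\<Sum>i<N. max (e i + 1) 0 * (v i $ a * v i $ b)) =
        spectral_sum N u (\<lambda>i. max (\<mu> i) 0) a b"
      using *[OF ab] by simp
  qed
qed

lemma mult_diagonal_entry:
  fixes C D :: "real mat"
  assumes C: "C \<in> carrier_mat N p" and D: "D \<in> carrier_mat p p" and "diagonal_mat D"
    and "a < N" "i < p"
  shows "(C * D) $$ (a, i) = D $$ (i, i) * C $$ (a, i)"
proof -
  have "(C * D) $$ (a, i) = (\<Sum>j<p. C $$ (a, j) * D $$ (j, i))"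
    by (rule mult_mat_entry[OF C D assms(4,5)])
  also have "\<dots> = (\<Sum>j<p. if j = i then D $$ (i, i) * C $$ (a, i) else 0)"
    using assms by (intro sum.cong) (auto simp: diagonal_mat_def)
  finally show ?thesis using assms(5) by simp
qed

lemma diagonal_sandwich:
  assumes C: "C \<in> carrier_mat N p" and D: "D \<in> carrier_mat p p" and "diagonal_mat D"
  shows "C * D * transpose_mat C =
    mat N N (\<lambda>(a, b). spectral_sum p (\<lambda>i a. C $$ (a, i)) (\<lambda>i. D $$ (i, i)) a b)"
proof (rule eq_matI; simp)
  fix a b assume ab: "a < N" "b < N"
  have "(C * D * transpose_mat C) $$ (a, b) = (\<Sum>i<p. (C * D) $$ (a, i) * C $$ (b, i))"
    unfolding mult_mat_entry[OF mult_carrier_mat[OF C D] transpose_carrier_mat[THEN iffD2, OF C] ab]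
    using C ab by (intro sum.cong refl) simp
  then show "(C * D * transpose_mat C) $$ (a, b) =
      spectral_sum p (\<lambda>i a. C $$ (a, i)) (\<lambda>i. D $$ (i, i)) a b"
    using ab by (simp add: mult_diagonal_entry[OF assms] spectral_sum_def del: index_mult_mat)
qed (use C in auto)

lemma truncated_sandwich:
  assumes C: "C \<in> carrier_mat N p" and D: "D \<in> carrier_mat p p" and "diagonal_mat D"
  shows "first_cols K C * leading_block K D * transpose_mat (first_cols K C) =
    mat N N (\<lambda>(a, b). spectral_sum (min K p) (\<lambda>i a. C $$ (a, i)) (\<lambda>i. D $$ (i, i)) a b)"
proof -
  have "first_cols K C \<in> carrier_mat N (min K p)" "leading_block K D \<in> carrier_mat (min K p) (min K p)"
    "diagonal_mat (leading_block K D)"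
    using assms by (auto simp: first_cols_def leading_block_def diagonal_mat_def)
  from diagonal_sandwich[OF this] show ?thesis
    using C D by (auto simp: spectral_sum_def first_cols_def leading_block_def intro!: eq_matI sum.cong)
qed

section \<open>The inverse kernel matrix\<close>

lemma mat_inv_props:
  assumes "M \<in> carrier_mat n n" "invertible_mat M"
  shows "mat_inv M \<in> carrier_mat n n" "M * mat_inv M = 1\<^sub>m n" "mat_inv M * M = 1\<^sub>m n"
proof -
  obtain B where B: "inverts_mat M B" "inverts_mat B M"
    using assms(2) by (auto simp: invertible_mat_def)
  then have "M * B = 1\<^sub>m n" "B * M = 1\<^sub>m (dim_row B)"
    using assms(1) by (auto simp: inverts_mat_def)
  \<comment> \<open>Comparing the dimensions on both sides of the two equations forces B to be n by
    n.\<close>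
  then have "B \<in> carrier_mat n n"
    using assms(1) by (metis carrier_matI carrier_matD index_mult_mat(2,3) index_one_mat(2,3))
  with \<open>M * B = 1\<^sub>m n\<close> \<open>B * M = _\<close> have "M \<in> Units (ring_mat TYPE(real) n ())"
    using assms(1) by (auto simp: Units_def ring_mat_simps)
  then obtain J where J: "mat_inverse M = Some J"
    using mat_inverse(1)[OF assms(1), where b = "()"] by (cases "mat_inverse M") auto
  from mat_inverse(2)[OF assms(1) J]
  show "mat_inv M \<in> carrier_mat n n" "M * mat_inv M = 1\<^sub>m n" "mat_inv M * M = 1\<^sub>m n"
    by (auto simp: mat_inv_def J)
qed

lemma mat_inv_sym:
  assumes M: "M \<in> carrier_mat n n" "invertible_mat M" and sym: "transpose_mat M = M"
  shows "transpose_mat (mat_inv M) = mat_inv M"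
proof -
  note J = mat_inv_props[OF M]
  have "transpose_mat (mat_inv M) * M = transpose_mat (M * mat_inv M)"
    unfolding transpose_mult[OF M(1) J(1)] sym ..
  then have "transpose_mat (mat_inv M) * M = 1\<^sub>m n"
    by (simp add: J)
  then have "transpose_mat (mat_inv M) * M * mat_inv M = mat_inv M" 
    using J by simp
  then show ?thesis
    using M J by (simp add: assoc_mult_mat[of _ n n _ n _ n])
qed

text \<open>Entry \<open>a\<close> of k_{y,s} K^{-1}. As functions of \<open>y\<close> these are the
  cardinal functions of interpolation: for an invertible kernel matrix they form the Kronecker delta
  at the datapoints.\<close>

definition kernel_coeff :: "('x \<Rightarrow> 'x \<Rightarrow> real) \<Rightarrow> nat \<Rightarrow> (nat \<Rightarrow> 'x) \<Rightarrow> 'x \<Rightarrow> nat \<Rightarrow> real" where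
  "kernel_coeff k N x y a = (\<Sum>j<N. k y (x j) * mat_inv (kernel_matrix k N x) $$ (j, a))"

lemma kernel_matrix_carrier: "kernel_matrix k N x \<in> carrier_mat N N"
  by (simp add: kernel_matrix_def)

lemma mat_inv_kernel_matrix_sym:
  assumes "\<And>y z. k y z = k z y" "invertible_mat (kernel_matrix k N x)" "a < N" "b < N"
  shows "mat_inv (kernel_matrix k N x) $$ (a, b) = mat_inv (kernel_matrix k N x) $$ (b, a)"
proof -
  let ?J = "mat_inv (kernel_matrix k N x)"
  have "transpose_mat (kernel_matrix k N x) = kernel_matrix k N x"
    using assms(1) by (auto simp: kernel_matrix_def)
  then have "transpose_mat ?J = ?J"
    by (rule mat_inv_sym[OF kernel_matrix_carrier assms(2)])
  moreover have "transpose_mat ?J $$ (a, b) = ?J $$ (b, a)"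
    using mat_inv_props(1)[OF kernel_matrix_carrier assms(2)] assms(3,4) by simp
  ultimately show ?thesis by simp
qed

lemma kernel_sandwich_eq:
  assumes sym: "\<And>y z. k y z = k z y" and inv: "invertible_mat (kernel_matrix k N x)"
    and M: "M \<in> carrier_mat N N"
  shows "kernel_sandwich k N x M y z =
    (\<Sum>a<N. \<Sum>b<N. kernel_coeff k N x y a * M $$ (a, b) * kernel_coeff k N x z b)"
proof -
  let ?J = "mat_inv (kernel_matrix k N x)" and ?r = "kernel_row k N x"
  have J: "?J \<in> carrier_mat N N" by (rule mat_inv_props(1)[OF kernel_matrix_carrier inv])
  have r: "?r w \<in> carrier_mat 1 N" for w by (simp add: kernel_row_def)
  have z1: "0 < (1::nat)" by simp
  have rT: "transpose_mat (?r w) \<in> carrier_mat N 1" for w by (simp add: kernel_row_def)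
  have left: "(?r w * ?J) $$ (0, a) = kernel_coeff k N x w a" if "a < N" for w a
    unfolding mult_mat_entry[OF r J z1 that] kernel_coeff_def
    by (simp add: kernel_row_def)
  \<comment> \<open>The inverse is symmetric, so K^{-1} k_{s,w} is the transpose of k_{w,s} K^{-1}
    and has the same entries.\<close>
  have right: "(?J * transpose_mat (?r w)) $$ (b, 0) = kernel_coeff k N x w b" if "b < N" for w b
    unfolding mult_mat_entry[OF J rT that z1] kernel_coeff_def
    using mat_inv_kernel_matrix_sym[where k = k, OF sym inv that]
    by (intro sum.cong refl) (simp add: kernel_row_def mult.commute)
  have "kernel_sandwich k N x M y z =
      ((?r y * ?J) * (M * (?J * transpose_mat (?r z)))) $$ (0, 0)"
    unfolding kernel_sandwich_def using J M r[of y] r[of z]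
    by (simp add: assoc_mult_mat[of _ 1 N _ N _ 1] assoc_mult_mat[of _ 1 N _ N _ N] assoc_mult_mat[of _ N N _ N _ 1])
  also have "\<dots> = (\<Sum>a<N. kernel_coeff k N x y a * (M * (?J * transpose_mat (?r z))) $$ (a, 0))"
    unfolding mult_mat_entry[OF mult_carrier_mat[OF r J]
        mult_carrier_mat[OF M mult_carrier_mat[OF J rT]] z1 z1]
    by (rule sum.cong[OF refl]) (simp only: left lessThan_iff)
  also have "\<dots> = (\<Sum>a<N. kernel_coeff k N x y a * (\<Sum>b<N. M $$ (a, b) * kernel_coeff k N x z b))"
  proof (rule sum.cong[OF refl])
    fix a assume "a \<in> {..<N}"
    then have "a < N" by simp
    show "kernel_coeff k N x y a * (M * (?J * transpose_mat (?r z))) $$ (a, 0) =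
        kernel_coeff k N x y a * (\<Sum>b<N. M $$ (a, b) * kernel_coeff k N x z b)"
      unfolding mult_mat_entry[OF M mult_carrier_mat[OF J rT] \<open>a < N\<close> z1]
      by (intro arg_cong2[of _ _ _ _ "(*)"] sum.cong refl) (simp only: right lessThan_iff)
  qed
  finally show ?thesis by (simp add: sum_distrib_left mult.assoc)
qed

section \<open>Reduction of the contrastive loss to Gram matrices\<close>

text \<open>The maps in the span of the \<open>\<Phi> (x j)\<close> with prescribed values \<open>V i a\<close> at the datapoints.\<close>

definition interpolant ::
  "('x \<Rightarrow> 'x \<Rightarrow> real) \<Rightarrow> ('x \<Rightarrow> 'h::real_inner) \<Rightarrow> nat \<Rightarrow> (nat \<Rightarrow> 'x) \<Rightarrow> (nat \<Rightarrow> nat \<Rightarrow> real) \<Rightarrow> nat \<Rightarrow> 'h" where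
  "interpolant k \<Phi> N x V i =
     (\<Sum>j<N. (\<Sum>a<N. V i a * mat_inv (kernel_matrix k N x) $$ (j, a)) *\<^sub>R \<Phi> (x j))"

lemma inner_interpolant:
  assumes repr: "\<And>y z. inner (\<Phi> y) (\<Phi> z) = k y z"
  shows "inner (interpolant k \<Phi> N x V i) (\<Phi> y) = (\<Sum>a<N. V i a * kernel_coeff k N x y a)"
proof -
  let ?J = "mat_inv (kernel_matrix k N x)"
  have "inner (\<Phi> (x j)) (\<Phi> y) = k y (x j)" for j
    using repr[of y "x j"] by (simp only: inner_commute)
  then have "inner (interpolant k \<Phi> N x V i) (\<Phi> y) =
      (\<Sum>j<N. \<Sum>a<N. V i a * (k y (x j) * ?J $$ (j, a)))"
    unfolding interpolant_def inner_sum_left inner_scaleR_left sum_distrib_right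
    by (simp only: mult_ac)
  also have "\<dots> = (\<Sum>a<N. V i a * kernel_coeff k N x y a)"
    unfolding kernel_coeff_def sum_distrib_left by (rule sum.swap)
  finally show ?thesis .
qed

lemma kernel_coeff_datapoint:
  assumes "invertible_mat (kernel_matrix k N x)" "b < N" "a < N"
  shows "kernel_coeff k N x (x b) a = (if a = b then 1 else 0)"
proof -
  note J = mat_inv_props[OF kernel_matrix_carrier assms(1)]
  have "kernel_coeff k N x (x b) a =
      (kernel_matrix k N x * mat_inv (kernel_matrix k N x)) $$ (b, a)"
    unfolding mult_mat_entry[OF kernel_matrix_carrier J(1) assms(2,3)] kernel_coeff_def
    using assms(2) by (intro sum.cong refl) (simp add: kernel_matrix_def)
  then show ?thesis using assms(2,3) by (simp only: J(2) index_one_mat) auto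
qed

lemma inner_interpolant_datapoint:
  assumes "\<And>y z. inner (\<Phi> y) (\<Phi> z) = k y z" "invertible_mat (kernel_matrix k N x)" "b < N"
  shows "inner (interpolant k \<Phi> N x V i) (\<Phi> (x b)) = V i b"
proof -
  have "inner (interpolant k \<Phi> N x V i) (\<Phi> (x b)) = (\<Sum>a<N. if a = b then V i a else 0)"
    unfolding inner_interpolant[where k = k, OF assms(1)]
    using kernel_coeff_datapoint[OF assms(2,3)] by (intro sum.cong) auto
  then show ?thesis using assms(3) by simp
qed

text \<open>The difference of \<open>w\<close> and the interpolant vanishes at the datapoints, that
  is, it is orthogonal to every \<open>\<Phi> (x j)\<close> and so to the interpolant, which lies in
  their span.\<close>

lemma inner_interpolant_pythagoras:
  assumes repr: "\<And>y z. inner (\<Phi> y) (\<Phi> z) = k y z" and inv: "invertible_mat (kernel_matrix k N x)"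
    and V: "\<And>b. b < N \<Longrightarrow> V i b = inner w (\<Phi> (x b))"
  shows "inner w w = inner (interpolant k \<Phi> N x V i) (interpolant k \<Phi> N x V i) +
    inner (w - interpolant k \<Phi> N x V i) (w - interpolant k \<Phi> N x V i)"
proof -
  let ?p = "interpolant k \<Phi> N x V i"
  have "inner (w - ?p) (\<Phi> (x j)) = 0" if "j < N" for j
    using that by (simp add: inner_diff_left inner_interpolant_datapoint[where k = k, OF repr inv] V)
  then have "inner (w - ?p) ?p = 0"
    by (subst (2) interpolant_def) (simp add: inner_sum_right)
  then have wp: "inner w ?p = inner ?p ?p" by (simp add: inner_diff_left)
  then have "inner ?p w = inner ?p ?p" by (simp only: inner_commute[of ?p w])
  with wp show ?thesis by (simp add: inner_diff_left inner_diff_right)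
qed

lemma map_kernel_eq: "map_kernel \<Phi> K W y z = (\<Sum>i<K. inner (W i) (\<Phi> y) * inner (W i) (\<Phi> z))"
  by (simp add: map_kernel_def apply_map_def scalar_prod_def lessThan_atLeast0)

lemma contrastive_loss_eq:
  assumes "A \<in> carrier_mat N N"
    and "\<And>i a. i < K \<Longrightarrow> a < N \<Longrightarrow> V i a = inner (W i) (\<Phi> (x a))"
  shows "contrastive_loss \<Phi> N x K A W = gram_loss N K (entries (1\<^sub>m N + A)) V"
  using assms
  by (simp add: contrastive_loss_def frobenius_norm_def gram_loss_def gram_def kernel_matrix_def
      map_kernel_eq sum_nonneg)

text \<open>Interpolants reach every V', so minimality over maps becomes minimality over all
  coefficient families. Minimality of the norm serves to identify W with its interpolant, which
  fixes the induced kernel away from the datapoints.\<close>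

lemma induced_kernel_gram:
  fixes k :: "'x \<Rightarrow> 'x \<Rightarrow> real" and \<Phi> :: "'x \<Rightarrow> 'h::real_inner"
  assumes repr: "\<And>y z. inner (\<Phi> y) (\<Phi> z) = k y z" and inv: "invertible_mat (kernel_matrix k N x)"
    and A: "A \<in> carrier_mat N N" and ind: "induced_kernel \<Phi> N x K A kstar"
  obtains V where "\<And>V'. gram_loss N K (entries (1\<^sub>m N + A)) V \<le> gram_loss N K (entries (1\<^sub>m N + A)) V'"
    "\<And>y z. kstar y z = (\<Sum>a<N. \<Sum>b<N. kernel_coeff k N x y a * gram K V a b * kernel_coeff k N x z b)"
proof -
  let ?B = "entries (1\<^sub>m N + A)" and ?I = "interpolant k \<Phi> N x"
  obtain W where W: "\<And>W'. contrastive_loss \<Phi> N x K A W \<le> contrastive_loss \<Phi> N x K A W'"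
    "\<And>W'. (\<And>W''. contrastive_loss \<Phi> N x K A W' \<le> contrastive_loss \<Phi> N x K A W'') \<Longrightarrow>
       rkhs_norm K W \<le> rkhs_norm K W'"
    and kstar: "kstar = map_kernel \<Phi> K W"
  proof -
    from ind obtain W where W: "is_arg_min (rkhs_norm K)
        (is_arg_min (contrastive_loss \<Phi> N x K A) (\<lambda>_. True)) W" "kstar = map_kernel \<Phi> K W"
      by (auto simp: induced_kernel_def)
    from W(1) show thesis
      by (intro that[of W] W(2)) (auto simp: is_arg_min_def not_less)
  qed
  define V where "V i a = inner (W i) (\<Phi> (x a))" for i a
  have loss_W: "contrastive_loss \<Phi> N x K A W = gram_loss N K ?B V"
    by (rule contrastive_loss_eq[OF A]) (simp add: V_def)
  have loss_I: "contrastive_loss \<Phi> N x K A (?I V') = gram_loss N K ?B V'" for V'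
    by (rule contrastive_loss_eq[OF A]) (simp add: inner_interpolant_datapoint[where k = k, OF repr inv])
  \<comment> \<open>The interpolant of V has the same loss as W, so it is among the minimizers,
    where W has least norm.\<close>
  have "rkhs_norm K W \<le> rkhs_norm K (?I V)"
    using W(1) by (intro W(2)) (simp only: loss_I loss_W[symmetric])
  then have "(\<Sum>i<K. inner (W i) (W i)) \<le> (\<Sum>i<K. inner (?I V i) (?I V i))"
    by (simp add: rkhs_norm_def)
  moreover have "(\<Sum>i<K. inner (W i) (W i)) =
      (\<Sum>i<K. inner (?I V i) (?I V i)) + (\<Sum>i<K. inner (W i - ?I V i) (W i - ?I V i))"
    unfolding sum.distrib[symmetric]
    by (intro sum.cong refl inner_interpolant_pythagoras[where k = k, OF repr inv]) (simp add: V_def)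
  ultimately have "(\<Sum>i<K. inner (W i - ?I V i) (W i - ?I V i)) \<le> 0" by simp
  then have "(\<Sum>i<K. inner (W i - ?I V i) (W i - ?I V i)) = 0"
    by (intro antisym sum_nonneg) auto
  then have W_eq: "W i = ?I V i" if "i < K" for i
    using that by (simp add: sum_nonneg_eq_0_iff)
  show thesis
  proof (rule that)
    show "gram_loss N K ?B V \<le> gram_loss N K ?B V'" for V'
      using W(1)[of "?I V'"] by (simp only: loss_I loss_W)
    fix y z
    let ?q = "kernel_coeff k N x"
    have "kstar y z = (\<Sum>i<K. (\<Sum>a<N. V i a * ?q y a) * (\<Sum>b<N. V i b * ?q z b))"
      unfolding kstar map_kernel_eq
      by (intro sum.cong refl) (simp add: W_eq inner_interpolant[where k = k, OF repr])
    also have "\<dots> = (\<Sum>i<K. \<Sum>a<N. \<Sum>b<N. ?q y a * (V i a * V i b) * ?q z b)"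
      by (simp only: sum_product) (simp add: mult_ac)
    also have "\<dots> = (\<Sum>a<N. \<Sum>i<K. \<Sum>b<N. ?q y a * (V i a * V i b) * ?q z b)"
      by (rule sum.swap)
    also have "\<dots> = (\<Sum>a<N. \<Sum>b<N. \<Sum>i<K. ?q y a * (V i a * V i b) * ?q z b)"
      by (intro sum.cong refl sum.swap)
    finally show "kstar y z = (\<Sum>a<N. \<Sum>b<N. ?q y a * gram K V a b * ?q z b)"
      by (simp only: gram_def sum_distrib_left sum_distrib_right)
  qed
qed

section \<open>Counting eigenvalues, and the pairwise case\<close>

lemma antitone_threshold:
  fixes \<mu> :: "nat \<Rightarrow> real"
  assumes "\<And>i j. i \<le> j \<Longrightarrow> j < n \<Longrightarrow> \<mu> j \<le> \<mu> i" and "\<And>s t. P s \<Longrightarrow> s \<le> t \<Longrightarrow> P t"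
  obtains q where "q \<le> n" "\<And>i. i < n \<Longrightarrow> P (\<mu> i) \<longleftrightarrow> i < q"
proof -
  \<comment> \<open>The length of the initial segment on which P holds; \<open>n\<close> is always a
    candidate, so \<open>q = n\<close> if P never fails.\<close>
  define q where "q = (LEAST i. i < n \<longrightarrow> \<not> P (\<mu> i))"
  have "q \<le> n" unfolding q_def by (rule Least_le) simp
  moreover have "P (\<mu> i) \<longleftrightarrow> i < q" if "i < n" for i
  proof
    assume "i < q"
    then show "P (\<mu> i)" using not_less_Least[of i "\<lambda>i. i < n \<longrightarrow> \<not> P (\<mu> i)"] by (simp add: q_def)
  next
    assume P: "P (\<mu> i)"
    have q: "q < n \<longrightarrow> \<not> P (\<mu> q)" unfolding q_def by (rule LeastI[of _ n]) simp
    show "i < q"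
    proof (rule ccontr)
      assume "\<not> i < q"
      then show False using q P assms(1)[of q i] assms(2)[of "\<mu> i" "\<mu> q"] that by simp
    qed
  qed
  ultimately show thesis by (rule that)
qed

text \<open>With f the indicator of P, f(B) is a projection whose trace is the number of eigenvalues
  satisfying P, and f(B) does not depend on the eigenbasis.\<close>

lemma eigenvalue_count_unique:
  assumes sym: "sym_on n B" and u: "eigenfamily n B n u \<mu>" and v: "eigenfamily n B n v \<nu>"
    and "q \<le> n" "\<And>i. i < n \<Longrightarrow> P (\<mu> i) \<longleftrightarrow> i < q"
    and "q' \<le> n" "\<And>i. i < n \<Longrightarrow> P (\<nu> i) \<longleftrightarrow> i < q'"
  shows "q = q'"
proof -
  let ?f = "\<lambda>t. if P t then 1 else 0 :: real"
  have on: "orthonormal n n u" "orthonormal n n v"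
    using u v by (auto simp: eigenfamily_def)
  have count: "(\<Sum>i<n. ?f (\<xi> i)) = real q0" if "q0 \<le> n" "\<And>i. i < n \<Longrightarrow> P (\<xi> i) \<longleftrightarrow> i < q0" for \<xi> q0
  proof -
    have "(\<Sum>i<n. ?f (\<xi> i)) = (\<Sum>i<n. if i < q0 then 1 else 0)"
      using that(2) by (intro sum.cong) auto
    also have "\<dots> = (\<Sum>i<q0. 1)"
      using that(1) by (intro sum.mono_neutral_cong_right) auto
    finally show ?thesis by simp
  qed
  have "(\<Sum>i<n. ?f (\<mu> i)) = (\<Sum>a<n. spectral_sum n u (\<lambda>i. ?f (\<mu> i)) a a)"
    by (rule trace_spectral_sum[OF on(1), symmetric])
  also have "\<dots> = (\<Sum>a<n. spectral_sum n v (\<lambda>i. ?f (\<nu> i)) a a)"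
    by (intro sum.cong refl spectral_sum_unique[OF sym u v]) auto
  also have "\<dots> = (\<Sum>i<n. ?f (\<nu> i))"
    by (rule trace_spectral_sum[OF on(2)])
  finally have "real q = real q'"
    by (simp only: count[OF assms(4,5)] count[OF assms(6,7)])
  then show ?thesis by simp
qed

lemma spectral_sum_restrict:
  assumes "r \<le> n" "\<And>i. i < r \<Longrightarrow> g i = h i" "\<And>i. r \<le> i \<Longrightarrow> i < n \<Longrightarrow> g i = 0"
  shows "spectral_sum n u g a b = spectral_sum r u h a b"
  unfolding spectral_sum_def using assms by (intro sum.mono_neutral_cong_right) auto

text \<open>The rows of \<open>A\<close> and, by symmetry, its columns sum to 1, so twice the form
  of \<open>I + A\<close> is the sum of all \<open>A $$ (i, j) * (v i + v j)\<^sup>2\<close>, as for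
  a signless Laplacian.\<close>

lemma pairwise_form_nonneg:
  assumes adj: "adjacency_matrix N A" and pair: "\<And>i. i < N \<Longrightarrow> \<exists>!j. j < N \<and> A $$ (i, j) = 1"
  shows "0 \<le> ip N v (mv N (entries (1\<^sub>m N + A)) v)"
proof -
  have A: "A \<in> carrier_mat N N" and A01: "\<And>i j. i < N \<Longrightarrow> j < N \<Longrightarrow> A $$ (i, j) \<in> {0, 1}"
    and T: "transpose_mat A = A"
    using adj by (auto simp: adjacency_matrix_def)
  have A_sym: "A $$ (i, j) = A $$ (j, i)" if "i < N" "j < N" for i j
    using A that index_transpose_mat(1)[of j A i] T by simp
  have row: "(\<Sum>j<N. A $$ (i, j)) = 1" if i: "i < N" for i
  proof -
    obtain j where j: "j < N \<and> A $$ (i, j) = 1" "\<forall>l. l < N \<and> A $$ (i, l) = 1 \<longrightarrow> l = j"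
      using pair[OF i] by (rule ex1E)
    have "A $$ (i, l) = (if l = j then 1 else 0)" if "l < N" for l
    proof (cases "l = j")
      case False
      then have "A $$ (i, l) \<noteq> 1" using spec[OF j(2), of l] that by blast
      then show ?thesis using A01[OF i that] False by simp
    qed (simp add: conjunct2[OF j(1)])
    then have "(\<Sum>l<N. A $$ (i, l)) = (\<Sum>l<N. if l = j then 1 else 0)"
      by (intro sum.cong) simp_all
    then show ?thesis using j(1) by simp
  qed
  have 1: "(\<Sum>i<N. \<Sum>j<N. A $$ (i, j) * (v i)\<^sup>2) = (\<Sum>i<N. (v i)\<^sup>2)"
    by (intro sum.cong refl) (simp add: row flip: sum_distrib_right)
  have 2: "(\<Sum>i<N. \<Sum>j<N. A $$ (i, j) * (v j)\<^sup>2) = (\<Sum>i<N. (v i)\<^sup>2)"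
  proof -
    have "(\<Sum>i<N. \<Sum>j<N. A $$ (i, j) * (v j)\<^sup>2) = (\<Sum>j<N. \<Sum>i<N. A $$ (i, j) * (v j)\<^sup>2)"
      by (rule sum.swap)
    also have "\<dots> = (\<Sum>j<N. \<Sum>i<N. A $$ (j, i) * (v j)\<^sup>2)"
      by (intro sum.cong refl) (simp add: A_sym)
    finally show ?thesis using 1 by (rule trans)
  qed
  have "2 * ip N v (mv N (entries (1\<^sub>m N + A)) v) =
      2 * (\<Sum>i<N. (v i)\<^sup>2 + (\<Sum>j<N. A $$ (i, j) * (v i * v j)))"
    unfolding ip_def
  proof (intro arg_cong2[of _ _ _ _ "(*)"] sum.cong refl)
    fix i assume "i \<in> {..<N}"
    then have "mv N (entries (1\<^sub>m N + A)) v i = v i + mv N (entries A) v i"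
      by (intro mv_one_plus[OF A]) simp
    then show "v i * mv N (entries (1\<^sub>m N + A)) v i = (v i)\<^sup>2 + (\<Sum>j<N. A $$ (i, j) * (v i * v j))"
      by (simp add: mv_def[of N "entries A"] distrib_left sum_distrib_left power2_eq_square mult_ac)
  qed
  also have "\<dots> = (\<Sum>i<N. \<Sum>j<N. A $$ (i, j) * (v i)\<^sup>2) +
      (\<Sum>i<N. \<Sum>j<N. A $$ (i, j) * (v j)\<^sup>2) + 2 * (\<Sum>i<N. \<Sum>j<N. A $$ (i, j) * (v i * v j))"
    by (simp add: 1 2 sum.distrib)
  also have "\<dots> = (\<Sum>i<N. \<Sum>j<N. A $$ (i, j) * (v i + v j)\<^sup>2)"
    unfolding sum_distrib_left sum.distrib[symmetric]
    by (intro sum.cong refl) (simp add: power2_sum distrib_left)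
  finally have "2 * ip N v (mv N (entries (1\<^sub>m N + A)) v) =
      (\<Sum>i<N. \<Sum>j<N. A $$ (i, j) * (v i + v j)\<^sup>2)" .
  moreover have "0 \<le> A $$ (i, j)" if "i < N" "j < N" for i j
    using A01[OF that] by auto
  then have "0 \<le> (\<Sum>i<N. \<Sum>j<N. A $$ (i, j) * (v i + v j)\<^sup>2)"
    by (intro sum_nonneg mult_nonneg_nonneg) auto
  ultimately show ?thesis by simp
qed

section \<open>The induced kernel\<close>

text \<open>Both truncations are f(B) for the same f. If \<open>K < p\<close>, f keeps the values
  from the K-th largest eigenvalue on and kills smaller ones, which cuts after exactly K members
  because of the gap; otherwise f(t) = max(t, 0).\<close>

lemma truncation_unique:
  assumes sym: "sym_on n B"
    and u: "eigenfamily n B n u \<mu>" "r \<le> K" "r \<le> n" "\<And>i. i < r \<Longrightarrow> 0 < \<mu> i"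
      "\<And>i j. i \<le> j \<Longrightarrow> j < n \<Longrightarrow> \<mu> j \<le> \<mu> i"
      "\<And>i. r < K \<Longrightarrow> r \<le> i \<Longrightarrow> i < n \<Longrightarrow> \<mu> i \<le> 0"
    and c: "eigenfamily n B n c e" "p \<le> n" "\<And>i. i < p \<Longrightarrow> 0 < e i"
      "\<And>i j. i \<le> j \<Longrightarrow> j < p \<Longrightarrow> e j \<le> e i" "\<And>i. p \<le> i \<Longrightarrow> i < n \<Longrightarrow> e i \<le> 0"
    and gap: "K < p \<Longrightarrow> e K < e (K - 1)"
    and "a < n" "b < n"
  shows "spectral_sum (min K p) c e a b = spectral_sum r u \<mu> a b"
proof -
  have same: "spectral_sum n c (\<lambda>i. f (e i)) a b = spectral_sum n u (\<lambda>i. f (\<mu> i)) a b" for f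
    by (rule spectral_sum_unique[OF sym c(1) u(1) \<open>a < n\<close> \<open>b < n\<close>])
  show ?thesis
  proof (cases "K < p")
    case True
    \<comment> \<open>The K-th largest eigenvalue, as indices start at 0.\<close>
    define d where "d = e (K - 1)"
    \<comment> \<open>For \<open>K = 0\<close>, truncated subtraction turns the gap into
      \<open>e 0 < e 0\<close>, so this case is excluded.\<close>
    have "K \<noteq> 0" using gap[OF True] by (cases K) auto
    have "0 < d" unfolding d_def using c(3)[of "K - 1"] True by simp
    have e_d: "d \<le> e i \<longleftrightarrow> i < K" if "i < n" for i
    proof
      assume "i < K"
      then show "d \<le> e i" unfolding d_def using c(4)[of i "K - 1"] True by simp
    next
      assume "d \<le> e i"
      show "i < K"
      proof (rule ccontr)
        assume "\<not> i < K"
        then have "e i < d"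
          using gap[OF True] c(4)[of K i] c(5)[OF _ that] \<open>0 < d\<close> unfolding d_def
          by (cases "i < p") auto
        with \<open>d \<le> e i\<close> show False by simp
      qed
    qed
    obtain q where q: "q \<le> n" "\<And>i. i < n \<Longrightarrow> d \<le> \<mu> i \<longleftrightarrow> i < q"
      by (rule antitone_threshold[where n = n and \<mu> = \<mu> and P = "\<lambda>t. d \<le> t"])
        (rule u(5), assumption, assumption, erule (1) order_trans, rule that)
    have "q = K"
      using sym u(1) c(1) q less_imp_le[OF less_le_trans[OF True c(2)]] e_d
      by (rule eigenvalue_count_unique[where P = "\<lambda>t. d \<le> t"])
    \<comment> \<open>If a row stayed free, the eigenvalues from index r on would be nonpositive,
      yet index r is among the K whose value is at least \<open>d > 0\<close>.\<close>
    have "r = K"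
    proof (rule ccontr)
      assume "r \<noteq> K"
      then have "r < K" "r < n" using u(2) True c(2) by auto
      then show False
        using u(6)[of r] q(2)[of r] \<open>q = K\<close> \<open>0 < d\<close> by simp
    qed
    let ?f = "\<lambda>t. if d \<le> t then t else 0"
    have "spectral_sum (min K p) c e a b = spectral_sum n c (\<lambda>i. ?f (e i)) a b"
      using True c(2) e_d by (subst spectral_sum_restrict[of K n _ e]) auto
    also have "\<dots> = spectral_sum n u (\<lambda>i. ?f (\<mu> i)) a b" by (rule same)
    also have "\<dots> = spectral_sum r u \<mu> a b"
      using u(3) q \<open>q = K\<close> \<open>r = K\<close> by (intro spectral_sum_restrict) auto
    finally show ?thesis .
  next
    case False
    obtain q where q: "q \<le> n" "\<And>i. i < n \<Longrightarrow> 0 < \<mu> i \<longleftrightarrow> i < q"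
      by (rule antitone_threshold[where n = n and \<mu> = \<mu> and P = "\<lambda>t. 0 < t"])
        (rule u(5), assumption, assumption, erule (1) less_le_trans, rule that)
    have e_pos: "0 < e i \<longleftrightarrow> i < p" if "i < n" for i
      using c(3)[of i] c(5)[of i] that by (cases "i < p") auto
    have "q = p"
      using sym u(1) c(1) q c(2) e_pos by (rule eigenvalue_count_unique[where P = "\<lambda>t. 0 < t"])
    \<comment> \<open>For \<open>r < K\<close> the minimizer leaves no positive eigenvalue out; for
      \<open>r = K\<close> the index is at least K, hence at least \<open>p = q\<close>, the number
      of positive eigenvalues.\<close>
    have \<mu>_le: "\<mu> i \<le> 0" if "r \<le> i" "i < n" for i
      using that u(2) u(6)[of i] q(2)[of i] False \<open>q = p\<close> by (cases "r < K") auto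
    have "spectral_sum (min K p) c e a b = spectral_sum n c (\<lambda>i. max (e i) 0) a b"
      using False c(2,3,5) by (subst spectral_sum_restrict[of p n _ e]) (auto simp: less_imp_le)
    also have "\<dots> = spectral_sum n u (\<lambda>i. max (\<mu> i) 0) a b" by (rule same)
    also have "\<dots> = spectral_sum r u \<mu> a b"
      using u(3,4) \<mu>_le by (intro spectral_sum_restrict) (auto simp: less_imp_le)
    finally show ?thesis .
  qed
qed

text \<open>The columns of \<open>C\<close> are completed to an eigenbasis of \<open>I + A\<close>.
  That the added eigenvalues are not positive comes from the equation between
  \<open>C * D * transpose_mat C\<close> and the positive part.\<close>

lemma positive_eigendecomposition_eigenfamily:
  assumes adj: "adjacency_matrix N A" and dec: "positive_eigendecomposition N A C D"
  obtains c e where "eigenfamily N (entries (1\<^sub>m N + A)) N c e" "dim_col C \<le> N"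
    "\<And>i. i < dim_col C \<Longrightarrow> c i = (\<lambda>a. C $$ (a, i))" "\<And>i. i < dim_col C \<Longrightarrow> e i = D $$ (i, i)"
    "\<And>i. dim_col C \<le> i \<Longrightarrow> i < N \<Longrightarrow> e i \<le> 0"
proof -
  define p where "p = dim_col C"
  let ?B = "entries (1\<^sub>m N + A)"
  have A: "A \<in> carrier_mat N N" using adj by (simp add: adjacency_matrix_def)
  have sym: "sym_on N ?B" by (rule adjacency_sym_on[OF adj])
  have C: "C \<in> carrier_mat N p" and D: "D \<in> carrier_mat p p" and diag: "diagonal_mat D"
    and CC: "transpose_mat C * C = 1\<^sub>m p" and BC: "(1\<^sub>m N + A) * C = C * D"
    and CDC: "C * D * transpose_mat C = pos_part_I_plus N A"
    using dec by (simp_all add: positive_eigendecomposition_def p_def)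
  have CT: "transpose_mat C \<in> carrier_mat p N" using C by simp
  have "orthonormal N p (\<lambda>i a. C $$ (a, i))"
    unfolding orthonormal_def
  proof (intro allI impI)
    fix i j assume ij: "i < p" "j < p"
    have "ip N (\<lambda>a. C $$ (a, i)) (\<lambda>a. C $$ (a, j)) = (transpose_mat C * C) $$ (i, j)"
      unfolding mult_mat_entry[OF CT C ij] ip_def using C ij by (intro sum.cong refl) simp
    then show "ip N (\<lambda>a. C $$ (a, i)) (\<lambda>a. C $$ (a, j)) = (if i = j then 1 else 0)"
      using ij by (simp only: CC index_one_mat)
  qed
  moreover have "mv N ?B (\<lambda>a. C $$ (a, i)) a = D $$ (i, i) * C $$ (a, i)" if "i < p" "a < N" for i a
  proof -
    have "mv N ?B (\<lambda>a. C $$ (a, i)) a = ((1\<^sub>m N + A) * C) $$ (a, i)"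
      using A by (subst mult_mat_entry[OF _ C \<open>a < N\<close> \<open>i < p\<close>]) (simp_all add: mv_def)
    then show ?thesis
      by (simp only: BC mult_diagonal_entry[OF C D diag \<open>a < N\<close> \<open>i < p\<close>])
  qed
  ultimately have fam: "eigenfamily N ?B p (\<lambda>i a. C $$ (a, i)) (\<lambda>i. D $$ (i, i))"
    by (simp add: eigenfamily_def)
  obtain c e where ce: "eigenfamily N ?B N c e" "\<And>i. i < p \<Longrightarrow> c i = (\<lambda>a. C $$ (a, i))"
    "\<And>i. i < p \<Longrightarrow> e i = D $$ (i, i)"
    using sym fam by (rule eigenfamily_extend_sorted) (rule that)
  have on: "orthonormal N N c" using ce(1) by (simp add: eigenfamily_def)
  have "p \<le> N" by (rule orthonormal_le_dim[OF conjunct1[OF fam[unfolded eigenfamily_def]]])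
  have "e j \<le> 0" if "p \<le> j" "j < N" for j
  proof -
    let ?S = "spectral_sum p (\<lambda>i a. C $$ (a, i)) (\<lambda>i. D $$ (i, i))"
    have same: "?S a b = spectral_sum N c (\<lambda>i. max (e i) 0) a b" if "a < N" "b < N" for a b
    proof -
      have "mat N N (\<lambda>(a, b). ?S a b) $$ (a, b) =
          mat N N (\<lambda>(a, b). spectral_sum N c (\<lambda>i. max (e i) 0) a b) $$ (a, b)"
        by (simp only: diagonal_sandwich[OF C D diag, symmetric] CDC pos_part_I_plus_eq[OF A sym ce(1)])
      then show ?thesis using that by simp
    qed
    \<comment> \<open>Both sides of that equation are applied to \<open>c j\<close>: one gives
      \<open>max (e j) 0\<close> times \<open>c j\<close>, the other 0, since \<open>c j\<close> is
      orthogonal to the columns of \<open>C\<close>.\<close>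
    have "max (e j) 0 * c j a = 0" if "a < N" for a
    proof -
      have "max (e j) 0 * c j a = mv N (spectral_sum N c (\<lambda>i. max (e i) 0)) (c j) a"
        by (rule mv_spectral_sum_basis[OF on \<open>j < N\<close>, symmetric])
      also have "\<dots> = mv N ?S (c j) a"
        unfolding mv_def using same[OF \<open>a < N\<close>] by (intro sum.cong refl) simp
      also have "\<dots> = (\<Sum>i<p. D $$ (i, i) * ip N (c i) (c j) * C $$ (a, i))"
        unfolding mv_spectral_sum using ce(2) by (intro sum.cong refl) simp
      also have "\<dots> = 0"
        using on \<open>p \<le> j\<close> \<open>j < N\<close> by (intro sum.neutral) (auto simp: orthonormal_def)
      finally show ?thesis .
    qed
    moreover have "\<not> (\<forall>a<N. c j a = 0)"
      using on \<open>j < N\<close> unfolding ip_self_eq_0[symmetric] by (simp add: orthonormal_def)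
    ultimately have "max (e j) 0 = 0" by (meson mult_eq_0_iff)
    then show ?thesis by (simp add: max_def split: if_splits)
  qed
  then show thesis
    using that[of c e] ce \<open>p \<le> N\<close> by (simp add: p_def)
qed

text \<open>Turns the eigenbasis adapted to a minimizer into the witness for the existence
  claim.\<close>

lemma positive_eigendecomposition_of_eigenfamily:
  assumes adj: "adjacency_matrix N A" and u: "eigenfamily N (entries (1\<^sub>m N + A)) N u \<mu>"
    and anti: "\<And>i j. i \<le> j \<Longrightarrow> j < N \<Longrightarrow> \<mu> j \<le> \<mu> i"
    and p: "p \<le> N" "\<And>i. i < N \<Longrightarrow> 0 < \<mu> i \<longleftrightarrow> i < p"
  shows "positive_eigendecomposition N A (mat N p (\<lambda>(a, i). u i a))
    (mat p p (\<lambda>(i, j). if i = j then \<mu> i else 0))" (is "positive_eigendecomposition N A ?C ?D")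
proof -
  let ?B = "entries (1\<^sub>m N + A)"
  have A: "A \<in> carrier_mat N N" using adj by (simp add: adjacency_matrix_def)
  have sym: "sym_on N ?B" by (rule adjacency_sym_on[OF adj])
  have C: "?C \<in> carrier_mat N p" and D: "?D \<in> carrier_mat p p" by simp_all
  have CT: "transpose_mat ?C \<in> carrier_mat p N" by simp
  have diag: "diagonal_mat ?D" by (simp add: diagonal_mat_def)
  have "transpose_mat ?C * ?C = 1\<^sub>m p"
  proof (rule eq_matI)
    fix i j assume "i < dim_row (1\<^sub>m p :: real mat)" "j < dim_col (1\<^sub>m p :: real mat)"
    then have ij: "i < p" "j < p" by simp_all
    have "(transpose_mat ?C * ?C) $$ (i, j) = ip N (u i) (u j)"
      unfolding mult_mat_entry[OF CT C ij] ip_def using ij by (intro sum.cong refl) simp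
    then show "(transpose_mat ?C * ?C) $$ (i, j) = 1\<^sub>m p $$ (i, j)"
      using ij u p(1) by (simp add: eigenfamily_def orthonormal_def)
  qed simp_all
  moreover have "(1\<^sub>m N + A) * ?C = ?C * ?D"
  proof (rule eq_matI)
    fix a i assume "a < dim_row (?C * ?D)" "i < dim_col (?C * ?D)"
    then have ai: "a < N" "i < p" by simp_all
    have "((1\<^sub>m N + A) * ?C) $$ (a, i) = mv N ?B (u i) a"
      using A ai by (subst mult_mat_entry[OF _ C ai]) (simp_all add: mv_def)
    also have "\<dots> = \<mu> i * u i a"
      using u ai p(1) by (simp add: eigenfamily_def)
    finally show "((1\<^sub>m N + A) * ?C) $$ (a, i) = (?C * ?D) $$ (a, i)"
      using ai by (simp only: mult_diagonal_entry[OF C D diag ai]) simp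
  qed (use A in simp_all)
  moreover have "?C * ?D * transpose_mat ?C = pos_part_I_plus N A"
    unfolding diagonal_sandwich[OF C D diag] pos_part_I_plus_eq[OF A sym u]
  proof (rule eq_matI; simp)
    fix a b assume ab: "a < N" "b < N"
    have "spectral_sum N u (\<lambda>i. max (\<mu> i) 0) a b = spectral_sum p u \<mu> a b"
    proof (rule spectral_sum_restrict[OF p(1)])
      show "max (\<mu> i) 0 = \<mu> i" if "i < p" for i
        using that p(1) p(2)[of i] by simp
      show "max (\<mu> i) 0 = 0" if "p \<le> i" "i < N" for i
        using that p(2)[of i] by simp
    qed
    then show "spectral_sum p (\<lambda>i a. ?C $$ (a, i)) (\<lambda>i. ?D $$ (i, i)) a b =
        spectral_sum N u (\<lambda>i. max (\<mu> i) 0) a b"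
      using ab by (simp add: spectral_sum_def)
  qed
  ultimately show ?thesis
    using diag p anti unfolding positive_eigendecomposition_def by auto
qed

lemma pairwise_eigenvalue_nonneg:
  assumes "adjacency_matrix N A" "\<And>i. i < N \<Longrightarrow> \<exists>!j. j < N \<and> A $$ (i, j) = 1"
    and "eigenvalue (1\<^sub>m N + A) l"
  shows "0 \<le> l"
proof -
  let ?B = "entries (1\<^sub>m N + A)"
  have A: "1\<^sub>m N + A \<in> carrier_mat N N" using assms(1) by (simp add: adjacency_matrix_def)
  obtain v where v: "v \<in> carrier_vec N" "v \<noteq> 0\<^sub>v N" "(1\<^sub>m N + A) *\<^sub>v v = l \<cdot>\<^sub>v v"
    using assms(3) A by (auto simp: eigenvalue_def eigenvector_def)
  have "mv N ?B (($) v) a = l * v $ a" if "a < N" for a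
    using v that by (simp only: mult_mat_vec_mv[OF A v(1) that, symmetric]) simp
  then have "ip N (($) v) (mv N ?B (($) v)) = ip N (($) v) (\<lambda>a. l * v $ a)"
    by (intro ip_cong) simp_all
  then have "0 \<le> l * ip N (($) v) (($) v)"
    using pairwise_form_nonneg[OF assms(1,2), of "($) v"] by (simp add: ip_scale_right)
  moreover have "ip N (($) v) (($) v) \<noteq> 0"
    unfolding ip_self_eq_0
  proof
    assume "\<forall>a<N. v $ a = 0"
    then have "v = 0\<^sub>v N" using v(1) by (intro eq_vecI) simp_all
    with v(2) show False by contradiction
  qed
  ultimately show ?thesis
    using ip_self_nonneg[of N "($) v"] by (simp add: zero_le_mult_iff)
qed

lemma pairwise_pos_part:
  assumes adj: "adjacency_matrix N A" and pair: "\<And>i. i < N \<Longrightarrow> \<exists>!j. j < N \<and> A $$ (i, j) = 1"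
    and u: "eigenfamily N (entries (1\<^sub>m N + A)) N u \<mu>"
  shows "pos_part_I_plus N A = 1\<^sub>m N + A"
proof -
  let ?B = "entries (1\<^sub>m N + A)"
  have A: "A \<in> carrier_mat N N" using adj by (simp add: adjacency_matrix_def)
  have "0 \<le> \<mu> i" if "i < N" for i
  proof -
    have "ip N (u i) (mv N ?B (u i)) = ip N (u i) (\<lambda>a. \<mu> i * u i a)"
      using u that by (intro ip_cong) (simp_all add: eigenfamily_def)
    then show ?thesis
      using pairwise_form_nonneg[OF adj pair, of "u i"] u that
      by (simp add: ip_scale_right eigenfamily_def orthonormal_def)
  qed
  then have "spectral_sum N u (\<lambda>i. max (\<mu> i) 0) a b = spectral_sum N u \<mu> a b" for a b
    unfolding spectral_sum_def by (intro sum.cong refl) (simp add: max_absorb1)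
  then show ?thesis
    unfolding pos_part_I_plus_eq[OF A adjacency_sym_on[OF adj] u]
    using A by (intro eq_matI) (simp_all add: spectral_decomposition[OF u, symmetric])
qed

text \<open>For \<open>K < N\<close>, a tie between the eigenvalues at positions K and K + 1 lets
  different choices of \<open>C\<close> give different truncations, so in general only some
  decomposition can be asserted to work; with a gap, every one does.\<close>

theorem mainTheorem2:
  fixes k :: "'x \<Rightarrow> 'x \<Rightarrow> real"
    and ev :: "'h::{real_inner,complete_space} \<Rightarrow> 'x \<Rightarrow> real"
    and \<Phi> :: "'x \<Rightarrow> 'h"
    and x :: "nat \<Rightarrow> 'x"
    and A :: "real mat"
    and N K :: nat
    and kstar :: "'x \<Rightarrow> 'x \<Rightarrow> real"
  assumes "psd_kernel k"
    and "is_rkhs k ev \<Phi>"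
    and "invertible_mat (kernel_matrix k N x)"
    and "adjacency_matrix N A"
    and "induced_kernel \<Phi> N x K A kstar"
  shows
    "(K \<ge> N \<longrightarrow>
        (\<forall>y z. kstar y z = kernel_sandwich k N x (pos_part_I_plus N A) y z)) \<and>
     ((\<forall>i<N. \<exists>!j. j < N \<and> A $$ (i, j) = 1) \<longrightarrow>
        (\<forall>l. eigenvalue (1\<^sub>m N + A) l \<longrightarrow> l \<ge> 0) \<and>
        pos_part_I_plus N A = 1\<^sub>m N + A \<and>
        (K \<ge> N \<longrightarrow> (\<forall>y z. kstar y z = kernel_sandwich k N x (1\<^sub>m N + A) y z))) \<and>
     (K < N \<longrightarrow>
        (\<exists>C D. positive_eigendecomposition N A C D \<and>
           (\<forall>y z. kstar y z =
              kernel_sandwich k N x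
                (first_cols K C * leading_block K D * transpose_mat (first_cols K C)) y z)) \<and>
        (\<forall>C D. positive_eigendecomposition N A C D \<longrightarrow>
           (K < dim_col C \<longrightarrow> D $$ (K, K) < D $$ (K - 1, K - 1)) \<longrightarrow>
           (\<forall>y z. kstar y z =
              kernel_sandwich k N x
                (first_cols K C * leading_block K D * transpose_mat (first_cols K C)) y z)))"
proof -
  let ?B = "entries (1\<^sub>m N + A)"
  note inv = assms(3) and adj = assms(4)
  have A: "A \<in> carrier_mat N N" using adj by (simp add: adjacency_matrix_def)
  have sym: "sym_on N ?B" by (rule adjacency_sym_on[OF adj])
  have repr: "inner (\<Phi> y) (\<Phi> z) = k y z" for y z
  proof -
    note rkhs = assms(2)[unfolded is_rkhs_def, THEN conjunct2]
    have "inner (\<Phi> y) (\<Phi> z) = ev (\<Phi> y) z"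
      by (rule rkhs[THEN conjunct2, rule_format, symmetric])
    also have "\<dots> = k y z"
      by (rule fun_cong[OF rkhs[THEN conjunct1, rule_format]])
    finally show ?thesis .
  qed
  have k_sym: "k y z = k z y" for y z
    unfolding repr[symmetric] by (rule inner_commute)
  obtain V where V: "\<And>V'. gram_loss N K ?B V \<le> gram_loss N K ?B V'"
    and kstar: "\<And>y z. kstar y z =
      (\<Sum>a<N. \<Sum>b<N. kernel_coeff k N x y a * gram K V a b * kernel_coeff k N x z b)"
    using repr inv A assms(5) by (rule induced_kernel_gram) (rule that)
  obtain u \<mu> r where u: "eigenfamily N ?B N u \<mu>" "r \<le> K" "r \<le> N" "\<And>i. i < r \<Longrightarrow> 0 < \<mu> i"
    "\<And>i j. i \<le> j \<Longrightarrow> j < N \<Longrightarrow> \<mu> j \<le> \<mu> i"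
    "\<And>i. r < K \<Longrightarrow> r \<le> i \<Longrightarrow> i < N \<Longrightarrow> \<mu> i \<le> 0"
    and gram: "\<And>a b. a < N \<Longrightarrow> b < N \<Longrightarrow> gram K V a b = spectral_sum r u \<mu> a b"
    using sym V by (rule gram_minimizer_truncation) (rule that)
  \<comment> \<open>All formulas for the induced kernel reduce to an entrywise identity with the
    truncated spectral sum of the minimizer.\<close>
  have sandwich: "kstar y z = kernel_sandwich k N x (mat N N (\<lambda>(a, b). S a b)) y z"
    if "\<And>a b. a < N \<Longrightarrow> b < N \<Longrightarrow> spectral_sum r u \<mu> a b = S a b" for S y z
    unfolding kstar kernel_sandwich_eq[where k = k, OF k_sym inv mat_carrier]
    by (intro sum.cong refl) (simp add: gram that)
  have full: "kstar y z = kernel_sandwich k N x (pos_part_I_plus N A) y z" if "K \<ge> N" for y z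
    unfolding pos_part_I_plus_eq[OF A sym u(1)]
  proof (rule sandwich)
    fix a b
    have "\<mu> i \<le> 0" if "r \<le> i" "i < N" for i
      using u(6)[of i] that \<open>K \<ge> N\<close> by simp
    then show "spectral_sum r u \<mu> a b = spectral_sum N u (\<lambda>i. max (\<mu> i) 0) a b"
      using u(3,4) by (intro spectral_sum_restrict[symmetric]) (auto simp: less_imp_le)
  qed
  have unique: "kstar y z = kernel_sandwich k N x
      (first_cols K C * leading_block K D * transpose_mat (first_cols K C)) y z"
    if dec: "positive_eigendecomposition N A C D"
      and gap: "K < dim_col C \<longrightarrow> D $$ (K, K) < D $$ (K - 1, K - 1)" for C D y z
  proof -
    define p where "p = dim_col C"
    have C: "C \<in> carrier_mat N p" and D: "D \<in> carrier_mat p p" and diag: "diagonal_mat D"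
      and D_pos: "\<And>i. i < p \<Longrightarrow> 0 < D $$ (i, i)"
      and D_anti: "\<And>i j. i \<le> j \<Longrightarrow> j < p \<Longrightarrow> D $$ (j, j) \<le> D $$ (i, i)"
      using dec by (simp_all add: positive_eigendecomposition_def p_def)
    obtain c e where c: "eigenfamily N ?B N c e" "p \<le> N"
      "\<And>i. i < p \<Longrightarrow> c i = (\<lambda>a. C $$ (a, i))" "\<And>i. i < p \<Longrightarrow> e i = D $$ (i, i)"
      "\<And>i. p \<le> i \<Longrightarrow> i < N \<Longrightarrow> e i \<le> 0"
      by (rule positive_eigendecomposition_eigenfamily[OF adj dec, folded p_def]) (rule that)
    show ?thesis
      unfolding truncated_sandwich[OF C D diag]
    proof (rule sandwich)
      fix a b assume ab: "a < N" "b < N"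
      have "spectral_sum (min K p) c e a b = spectral_sum r u \<mu> a b"
      proof (rule truncation_unique[OF sym u c(1,2) _ _ c(5) _ ab])
        show "0 < e i" if "i < p" for i using that D_pos by (simp add: c(4))
        show "e j \<le> e i" if "i \<le> j" "j < p" for i j using that D_anti by (simp add: c(4))
        show "e K < e (K - 1)" if "K < p" using that gap by (simp add: c(4) p_def)
      qed
      moreover have "spectral_sum (min K p) c e a b =
          spectral_sum (min K p) (\<lambda>i a. C $$ (a, i)) (\<lambda>i. D $$ (i, i)) a b"
        unfolding spectral_sum_def by (intro sum.cong refl) (simp add: c(3,4))
      ultimately show "spectral_sum r u \<mu> a b =
          spectral_sum (min K p) (\<lambda>i a. C $$ (a, i)) (\<lambda>i. D $$ (i, i)) a b"
        by simp
    qed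
  qed
  have existence: "\<exists>C D. positive_eigendecomposition N A C D \<and>
      (\<forall>y z. kstar y z = kernel_sandwich k N x
        (first_cols K C * leading_block K D * transpose_mat (first_cols K C)) y z)"
  proof -
    obtain p where p: "p \<le> N" "\<And>i. i < N \<Longrightarrow> 0 < \<mu> i \<longleftrightarrow> i < p"
      by (rule antitone_threshold[where n = N and \<mu> = \<mu> and P = "\<lambda>t. 0 < t"])
        (rule u(5), assumption, assumption, erule (1) less_le_trans, rule that)
    \<comment> \<open>Kept eigenvalues are positive, so r is at most p; while a row is free no
      positive eigenvalue is left out, so \<open>r < K\<close> forces
      \<open>p \<le> r\<close>.\<close>
    have r: "min K p = r"
    proof -
      have "r \<le> p"
      proof (rule ccontr)
        assume "\<not> r \<le> p"
        then show False using p(2)[of p] u(3) u(4)[of p] by simp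
      qed
      moreover have "p \<le> r" if "r < K"
      proof (rule ccontr)
        assume "\<not> p \<le> r"
        then show False using p(1) p(2)[of r] u(6)[OF that, of r] by simp
      qed
      ultimately show ?thesis using u(2) by (cases "r < K") auto
    qed
    \<comment> \<open>The witness is read off the eigenbasis adapted to the minimizer, so a tie at
      position K is resolved as the minimizer resolves it.\<close>
    let ?C = "mat N p (\<lambda>(a, i). u i a)" and ?D = "mat p p (\<lambda>(i, j). if i = j then \<mu> i else 0)"
    have C: "?C \<in> carrier_mat N p" and D: "?D \<in> carrier_mat p p" by simp_all
    have diag: "diagonal_mat ?D" by (simp add: diagonal_mat_def)
    have "kstar y z = kernel_sandwich k N x
        (first_cols K ?C * leading_block K ?D * transpose_mat (first_cols K ?C)) y z" for y z
      unfolding truncated_sandwich[OF C D diag]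
    proof (rule sandwich)
      fix a b assume "a < N" "b < N"
      then show "spectral_sum r u \<mu> a b =
          spectral_sum (min K p) (\<lambda>i a. ?C $$ (a, i)) (\<lambda>i. ?D $$ (i, i)) a b"
        unfolding spectral_sum_def r[symmetric] by (intro sum.cong refl) simp
    qed
    then show ?thesis
      using positive_eigendecomposition_of_eigenfamily[OF adj u(1,5) p] by (intro exI conjI allI)
  qed
  have pairwise: "(\<forall>l. eigenvalue (1\<^sub>m N + A) l \<longrightarrow> l \<ge> 0) \<and> pos_part_I_plus N A = 1\<^sub>m N + A"
    if "\<forall>i<N. \<exists>!j. j < N \<and> A $$ (i, j) = 1"
    using pairwise_eigenvalue_nonneg[OF adj that[rule_format]]
      pairwise_pos_part[OF adj that[rule_format] u(1)] by (intro conjI allI impI)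
  show ?thesis
  proof (intro conjI impI)
    show "\<forall>y z. kstar y z = kernel_sandwich k N x (pos_part_I_plus N A) y z" if "K \<ge> N"
      using full[OF that] by (intro allI)
    assume pair: "\<forall>i<N. \<exists>!j. j < N \<and> A $$ (i, j) = 1"
    show "\<forall>l. eigenvalue (1\<^sub>m N + A) l \<longrightarrow> l \<ge> 0" by (rule conjunct1[OF pairwise[OF pair]])
    show pos: "pos_part_I_plus N A = 1\<^sub>m N + A" by (rule conjunct2[OF pairwise[OF pair]])
    show "\<forall>y z. kstar y z = kernel_sandwich k N x (1\<^sub>m N + A) y z" if "K \<ge> N"
      using full[OF that] unfolding pos by (intro allI)
  next
    show "\<exists>C D. positive_eigendecomposition N A C D \<and>
        (\<forall>y z. kstar y z = kernel_sandwich k N x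
          (first_cols K C * leading_block K D * transpose_mat (first_cols K C)) y z)"
      by (rule existence)
    show "\<forall>C D. positive_eigendecomposition N A C D \<longrightarrow>
        (K < dim_col C \<longrightarrow> D $$ (K, K) < D $$ (K - 1, K - 1)) \<longrightarrow>
        (\<forall>y z. kstar y z = kernel_sandwich k N x
          (first_cols K C * leading_block K D * transpose_mat (first_cols K C)) y z)"
      using unique by (intro allI impI)
  qed
qed

end
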